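(* Consider the Gaussian sequence experiment with information level $n$, $Y_j=\kappa_j\theta_j+n^{-1/2}\varepsilon_j$, $j\ge 1$, where the $\varepsilon_j\sim N(0,\sigma^2)$ and the $\theta_j\sim N(0,\tau_j^2)$ are all mutually independent, $\kappa_j>0$, $\tau_j>0$, $\sigma>0$. Let $a_j=\kappa_j^2\tau_j^2/\sigma^2$, enumerated so that $a_1\ge a_2\ge\cdots>0$. Suppose that, for some $q>1$ and constants $0<c_1\le c_2<\infty$, $c_1j^{-q}\le a_j\le c_2j^{-q}$ for all $j\ge1$. Then, as $n\to\infty$, $I(\theta;Y)\asymp n^{1/q}$ and $d_{\rm eff}(n)\asymp n^{1/q}/\log n$. In particular, if $\kappa_j^2\asymp j^{-2a}$ and $\tau_j^2\asymp j^{-1-2s}$, where $2a+2s+1>1$, then \[ d_{\rm eff}(n)\asymp\frac{n^{1/(2a+2s+1)}}{\log n}. \]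
   Context: $\theta=(\theta_j)_{j\ge1}$, $Y=(Y_j)_{j\ge1}$. $I(U;V)=\mathrm{KL}(P_{U,V}\,\|\,P_U\otimes P_V)$ denotes mutual information (natural logarithm), here under the joint prior–sampling law of $(\theta,Y)$ at information level $n$. The sequences $\kappa_j,\tau_j$ and $\sigma$ do not depend on $n$. Whenever $\sum_j a_j<\infty$ one has $2I(\theta;Y)=\sum_{j\ge1}\log(1+na_j)$. The Bayesian effective dimension is $d_{\rm eff}(n)=2I(\theta;Y)/\log n$ for $n\ge3$. For positive sequences, $u_n\asymp v_n$ means that $u_n/v_n$ is bounded above and below by positive constants. *)

theory Defs
  imports "HOL-Probability.Probability"
begin

text \<open>
  Sequences are indexed by \<open>{1..}\<close>; values at index \<open>0\<close> are irrelevant throughout.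
\<close>

definition gaussian_sequence_experiment ::
    "'w measure \<Rightarrow> (nat \<Rightarrow> 'w \<Rightarrow> real) \<Rightarrow> (nat \<Rightarrow> 'w \<Rightarrow> real) \<Rightarrow>
      (nat \<Rightarrow> real) \<Rightarrow> (nat \<Rightarrow> real) \<Rightarrow> real \<Rightarrow> bool" where
  "gaussian_sequence_experiment M \<theta> \<epsilon> \<kappa> \<tau> \<sigma> \<longleftrightarrow>
     prob_space M \<and>
     (\<forall>j\<ge>1. \<kappa> j > 0) \<and> (\<forall>j\<ge>1. \<tau> j > 0) \<and> \<sigma> > 0 \<and>
     (\<forall>j\<ge>1. distributed M lborel (\<theta> j) (normal_density 0 (\<tau> j))) \<and>
     (\<forall>j\<ge>1. distributed M lborel (\<epsilon> j) (normal_density 0 \<sigma>)) \<and>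
     prob_space.indep_vars M (\<lambda>_. borel) (case_sum \<theta> \<epsilon>) ({1..} <+> {1..})"
  \<comment> \<open>\<open>normal_density\<close> takes the standard deviation, not the variance.
      Independence over the disjoint sum of the two index sets means that all \<open>\<theta> j\<close> and
      all \<open>\<epsilon> j\<close> together form one mutually independent family.\<close>

definition observation ::
    "(nat \<Rightarrow> 'w \<Rightarrow> real) \<Rightarrow> (nat \<Rightarrow> 'w \<Rightarrow> real) \<Rightarrow> (nat \<Rightarrow> real) \<Rightarrow> nat \<Rightarrow> nat \<Rightarrow> 'w \<Rightarrow> real" where
  "observation \<theta> \<epsilon> \<kappa> n j \<omega> = \<kappa> j * \<theta> j \<omega> + real n powr (-1/2) * \<epsilon> j \<omega>"

definition snr :: "(nat \<Rightarrow> real) \<Rightarrow> (nat \<Rightarrow> real) \<Rightarrow> real \<Rightarrow> nat \<Rightarrow> real" where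
  "snr \<kappa> \<tau> \<sigma> j = (\<kappa> j)\<^sup>2 * (\<tau> j)\<^sup>2 / \<sigma>\<^sup>2"

definition seq_variable :: "(nat \<Rightarrow> 'w \<Rightarrow> real) \<Rightarrow> 'w \<Rightarrow> nat \<Rightarrow> real" where
  "seq_variable X \<omega> = (\<lambda>j\<in>{1..}. X j \<omega>)"

abbreviation seq_space :: "(nat \<Rightarrow> real) measure" where
  "seq_space \<equiv> Pi\<^sub>M {1..} (\<lambda>_. borel)"

text \<open>
  The library's mutual information is real-valued. It is the Kullback-Leibler divergence whenever
  the joint law is absolutely continuous with respect to the product of the marginals and the
  divergence is finite; otherwise it is \<open>0\<close>, so a positive value is always a genuine divergence.
\<close>

definition info ::
    "'w measure \<Rightarrow> (nat \<Rightarrow> 'w \<Rightarrow> real) \<Rightarrow> (nat \<Rightarrow> 'w \<Rightarrow> real) \<Rightarrow> (nat \<Rightarrow> real) \<Rightarrow> nat \<Rightarrow> real" where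
  "info M \<theta> \<epsilon> \<kappa> n =
     prob_space.mutual_information M (exp 1) seq_space seq_space
       (seq_variable \<theta>) (seq_variable (observation \<theta> \<epsilon> \<kappa> n))"

definition d_eff ::
    "'w measure \<Rightarrow> (nat \<Rightarrow> 'w \<Rightarrow> real) \<Rightarrow> (nat \<Rightarrow> 'w \<Rightarrow> real) \<Rightarrow> (nat \<Rightarrow> real) \<Rightarrow> nat \<Rightarrow> real" where
  "d_eff M \<theta> \<epsilon> \<kappa> n = 2 * info M \<theta> \<epsilon> \<kappa> n / ln (real n)"

text \<open>
  \<open>u \<asymp> v\<close> for sequences with index set \<open>S\<close>: the ratio is bounded above and below by positive
  constants over all of \<open>S\<close>, not merely eventually.
\<close>

definition comparable_on :: "nat set \<Rightarrow> (nat \<Rightarrow> real) \<Rightarrow> (nat \<Rightarrow> real) \<Rightarrow> bool" where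
  "comparable_on S u v \<longleftrightarrow> (\<exists>c>0. \<exists>C>0. \<forall>n\<in>S. c \<le> u n / v n \<and> u n / v n \<le> C)"

end

theory Submission
  imports Defs
begin

text \<open>
  The joint law of \<open>(\<theta>, Y)\<close> is compared with the product \<open>Q\<close> of its marginals. The pairs
  \<open>(\<theta>\<^sub>j, Y\<^sub>j)\<close> are independent, and the law of each has a density \<open>g\<^sub>j\<close> with respect to
  the product of its marginals, a ratio of two normal densities. The partial products of the
  \<open>g\<^sub>j\<close> form a martingale under \<open>Q\<close> whose second moments are the partial products of
  \<open>1 + n a\<^sub>j\<close>. These are bounded, so the martingale converges in \<open>L\<^sup>1(Q)\<close> to the density
  \<open>f\<close> of the joint law.

  The exact value of the mutual information is not needed. By \<open>ln x \<le> x - 1\<close>, the divergence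
  \<open>\<integral> f ln f \<partial>Q\<close> is at most the logarithm of the second moment of \<open>f\<close>, and it is at
  least the integral of the logarithm of any partial product against the joint law. Hence the
  information lies between \<open>(\<Sum>j\<le>N. ln (1 + n a\<^sub>j)) / 2\<close>, for any \<open>N\<close>, and any bound on
  \<open>\<Sum>j\<le>N. ln (1 + n a\<^sub>j)\<close> that is uniform in \<open>N\<close>. For \<open>a\<^sub>j\<close> of order
  \<open>j powr (-q)\<close> both are of order \<open>n powr (1/q)\<close>: about that many terms are bounded below,
  and the rest of the sum is dominated by its beginning.
\<close>

section \<open>Square integrable densities and divergence bounds\<close>

lemma (in prob_space) integrable_of_square_bound:
  fixes f :: "'a \<Rightarrow> real"
  assumes [measurable]: "f \<in> borel_measurable M"
    and sq: "(\<integral>\<^sup>+x. ennreal ((f x)\<^sup>2) \<partial>M) \<le> ennreal C"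
  shows "integrable M (\<lambda>x. (f x)\<^sup>2)" and "integrable M f"
proof -
  show sqi: "integrable M (\<lambda>x. (f x)\<^sup>2)"
    using sq by (intro integrableI_nonneg) (auto simp: less_top[symmetric] top_unique)
  show "integrable M f"
    by (rule square_integrable_imp_integrable[OF _ sqi]) simp
qed

text \<open>Jensen's inequality for the logarithm under the law with density \<open>f\<close>,
  obtained pointwise: \<open>ln u \<le> u - 1\<close> at \<open>u = f x / C\<close>, multiplied by
  \<open>f x\<close>, gives \<open>f ln f \<le> (ln C - 1) f + f\<^sup>2 / C\<close>. Integration
  leaves at most \<open>ln C - 1 + 1\<close>.\<close>

lemma (in prob_space) KL_density_le_ln:
  fixes f :: "'a \<Rightarrow> real"
  assumes [measurable]: "f \<in> borel_measurable M" and nn: "\<And>x. 0 \<le> f x"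
    and sq: "(\<integral>\<^sup>+x. ennreal ((f x)\<^sup>2) \<partial>M) \<le> ennreal C"
    and int1: "(\<integral>x. f x \<partial>M) = 1" and C: "C > 0"
  shows "integrable M (\<lambda>x. f x * ln (f x))"
    and "KL_divergence (exp 1) M (density M f) \<le> ln C"
proof -
  note i = integrable_of_square_bound[OF assms(1) sq]
  show int: "integrable M (\<lambda>x. f x * ln (f x))"
  proof (rule Bochner_Integration.integrable_bound[where f="\<lambda>x. 1 + (f x)\<^sup>2"])
    show "AE x in M. norm (f x * ln (f x)) \<le> norm (1 + (f x)\<^sup>2)"
    proof (intro AE_I2)
      fix x
      \<comment> \<open>The two signs come from \<open>ln u \<le> u - 1\<close> at
        \<open>u = y\<close> and at \<open>u = 1 / y\<close>.\<close>
      have "\<bar>y * ln y\<bar> \<le> 1 + y\<^sup>2" if y: "y > 0" for y :: real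
      proof -
        have "y * ln y \<le> y * (y - 1)" using y ln_le_minus_one[of y] by (intro mult_left_mono) auto
        moreover have "y * ln (1 / y) \<le> y * (1 / y - 1)"
          using y ln_le_minus_one[of "1/y"] by (intro mult_left_mono) auto
        moreover have "y * ln (1 / y) = - (y * ln y)" "y * (1 / y - 1) = 1 - y"
          "y * (y - 1) = y\<^sup>2 - y"
          using y by (auto simp: ln_div power2_eq_square field_simps)
        ultimately have "y * ln y \<le> y\<^sup>2" "- (y * ln y) \<le> 1" using y by linarith+
        moreover have "0 \<le> y\<^sup>2" by simp
        ultimately show ?thesis by linarith
      qed
      from this[of "f x"] nn[of x] show "norm (f x * ln (f x)) \<le> norm (1 + (f x)\<^sup>2)"
        by (cases "f x = 0") (auto simp: less_le)
    qed
  qed (use i in auto)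
  have "KL_divergence (exp 1) M (density M f) = (\<integral>x. f x * ln (f x) \<partial>M)"
    using nn by (subst KL_density) (auto simp: log_ln)
  also have "\<dots> \<le> (\<integral>x. (ln C - 1) * f x + (f x)\<^sup>2 / C \<partial>M)"
  proof (rule integral_mono[OF int])
    fix x
    show "f x * ln (f x) \<le> (ln C - 1) * f x + (f x)\<^sup>2 / C"
    proof (cases "f x = 0")
      case False
      with nn[of x] have "f x > 0" by auto
      then have "f x * ln (f x / C) \<le> f x * (f x / C - 1)"
        using C ln_le_minus_one[of "f x / C"] by (intro mult_left_mono) auto
      with \<open>f x > 0\<close> C show ?thesis
        by (simp add: ln_div algebra_simps power2_eq_square)
    qed auto
  qed (use i in auto)
  also have "\<dots> = (ln C - 1) + (\<integral>x. (f x)\<^sup>2 \<partial>M) / C"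
    using i int1 by simp
  also have "(\<integral>x. (f x)\<^sup>2 \<partial>M) \<le> C"
  proof -
    have "ennreal (\<integral>x. (f x)\<^sup>2 \<partial>M) \<le> ennreal C"
      using sq i by (subst nn_integral_eq_integral[symmetric]) auto
    then show ?thesis using C by (simp add: ennreal_le_iff)
  qed
  then have "(ln C - 1) + (\<integral>x. (f x)\<^sup>2 \<partial>M) / C \<le> ln C" using C by (simp add: field_simps)
  finally show "KL_divergence (exp 1) M (density M f) \<le> ln C" .
qed

text \<open>Gibbs' inequality: \<open>ln u \<le> u - 1\<close> at \<open>u = g x / f x\<close> gives
  \<open>f ln g + f - g \<le> f ln f\<close>, and the correction \<open>f - g\<close> has
  nonnegative integral because \<open>g\<close> has mass at most 1. It serves to test the divergence
  with a partial product as \<open>g\<close>, whose logarithm is a finite sum over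
  coordinates.\<close>

lemma (in prob_space) KL_density_ge:
  fixes f g :: "'a \<Rightarrow> real"
  assumes [measurable]: "f \<in> borel_measurable M" and nn: "\<And>x. 0 \<le> f x"
    and int: "integrable M (\<lambda>x. f x * ln (f x))"
    and int1: "integrable M f" "(\<integral>x. f x \<partial>M) = 1"
    and g: "\<And>x. g x > 0" "integrable M g" "(\<integral>x. g x \<partial>M) \<le> 1"
    and intg: "integrable (density M f) (\<lambda>x. ln (g x))"
  shows "(\<integral>x. ln (g x) \<partial>density M f) \<le> KL_divergence (exp 1) M (density M f)"
proof -
  have [measurable]: "g \<in> borel_measurable M" using g by auto
  have intg': "integrable M (\<lambda>x. f x * ln (g x))"
    using intg nn by (subst (asm) integrable_real_density) auto
  have "(\<integral>x. ln (g x) \<partial>density M f) = (\<integral>x. f x * ln (g x) \<partial>M)"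
    using nn by (subst integral_real_density) auto
  also have "\<dots> \<le> (\<integral>x. f x * ln (g x) + f x - g x \<partial>M)"
    using g int1 intg' by simp
  also have "\<dots> \<le> (\<integral>x. f x * ln (f x) \<partial>M)"
  proof (rule integral_mono[OF _ int])
    fix x
    show "f x * ln (g x) + f x - g x \<le> f x * ln (f x)"
    proof (cases "f x = 0")
      case True then show ?thesis using g(1)[of x] by auto
    next
      case False
      with nn[of x] have f: "f x > 0" by auto
      then have "f x * ln (g x / f x) \<le> f x * (g x / f x - 1)"
        using g(1)[of x] ln_le_minus_one[of "g x / f x"] by (intro mult_left_mono) auto
      with f g(1)[of x] show ?thesis
        by (simp add: ln_div algebra_simps)
    qed
  qed (use g int1 intg' in auto)
  also have "\<dots> = KL_divergence (exp 1) M (density M f)"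
    using nn by (subst KL_density) (auto simp: log_ln)
  finally show ?thesis .
qed

text \<open>The hypothesis \<open>inner\<close> is the only trace of the martingale property: it
  makes increments orthogonal, so that the squared L2 distance of \<open>F n\<close> and
  \<open>F m\<close> is \<open>c n - c m\<close>. As \<open>c\<close> increases and is bounded,
  \<open>F\<close> is Cauchy in L2 and hence in L1. An almost everywhere convergent subsequence
  provides the limit, and Fatou's lemma provides the moment bound and the L1 convergence along it.
  The subsequence suffices later, where the integrals over a cylinder are eventually
  constant.\<close>

lemma (in prob_space) L2_martingale_limit:
  fixes F :: "nat \<Rightarrow> 'a \<Rightarrow> real" and c :: "nat \<Rightarrow> real"
  assumes [measurable]: "\<And>n. F n \<in> borel_measurable M" and nn: "\<And>n x. 0 \<le> F n x"
    and inner: "\<And>m n. m \<le> n \<Longrightarrow> (\<integral>\<^sup>+x. ennreal (F m x * F n x) \<partial>M) = ennreal (c m)"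
    and c0: "\<And>n. 0 \<le> c n" and cC: "\<And>n. c n \<le> C"
  obtains f r where "f \<in> borel_measurable M" "\<And>x. 0 \<le> f x" "strict_mono r"
    "(\<integral>\<^sup>+x. ennreal ((f x)\<^sup>2) \<partial>M) \<le> ennreal C"
    "\<And>A. A \<in> sets M \<Longrightarrow> (\<lambda>i. \<integral>\<^sup>+x. ennreal (F (r i) x) * indicator A x \<partial>M)
        \<longlonglongrightarrow> (\<integral>\<^sup>+x. ennreal (f x) * indicator A x \<partial>M)"
proof -
  have ii: "integrable M (\<lambda>x. F m x * F n x)" "(\<integral>x. F m x * F n x \<partial>M) = c m" if "m \<le> n" for m n
    using inner[OF that] nn c0
    by (auto intro!: integrableI_nonneg integral_eq_nn_integral[THEN trans])
  have sqI: "integrable M (\<lambda>x. (F n x)\<^sup>2)" for n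
    using ii[of n n] by (simp add: power2_eq_square)
  have FI[simp]: "integrable M (F n)" for n
    by (rule square_integrable_imp_integrable[OF _ sqI]) simp
  have diff: "integrable M (\<lambda>x. (F n x - F m x)\<^sup>2)" "(\<integral>x. (F n x - F m x)\<^sup>2 \<partial>M) = c n - c m"
    if "m \<le> n" for m n
  proof -
    have e: "(F n x - F m x)\<^sup>2 = F n x * F n x - 2 * (F m x * F n x) + F m x * F m x" for x
      by (simp add: power2_eq_square algebra_simps)
    show "integrable M (\<lambda>x. (F n x - F m x)\<^sup>2)" "(\<integral>x. (F n x - F m x)\<^sup>2 \<partial>M) = c n - c m"
      unfolding e using ii[of n n] ii[of m m] ii[OF that] by auto
  qed
  have "incseq c"
  proof (rule incseq_SucI)
    fix n
    have "0 \<le> (\<integral>x. (F (Suc n) x - F n x)\<^sup>2 \<partial>M)" by simp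
    with diff[of n "Suc n"] show "c n \<le> c (Suc n)" by simp
  qed
  then obtain L where "c \<longlonglongrightarrow> L" using cC incseq_convergent[of c C] by blast
  then have "Cauchy c" by (rule LIMSEQ_imp_Cauchy)
  \<comment> \<open>Instead of Cauchy-Schwarz, the weighted arithmetic-geometric mean inequality
    \<open>\<bar>d\<bar> \<le> e / 2 + d\<^sup>2 / (2 * e)\<close> is integrated.\<close>
  have L1: "(\<integral>x. norm (F i x - F j x) \<partial>M) \<le> e / 2 + \<bar>c i - c j\<bar> / (2 * e)" if e: "e > 0" for e :: real and i j
  proof -
    have *: "(\<integral>x. norm (F n x - F m x) \<partial>M) \<le> e / 2 + (c n - c m) / (2 * e)" if "m \<le> n" for m n
    proof -
      have "(\<integral>x. norm (F n x - F m x) \<partial>M) \<le> (\<integral>x. e / 2 + (F n x - F m x)\<^sup>2 / (2 * e) \<partial>M)"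
      proof (rule integral_mono)
        fix x
        have "0 \<le> (\<bar>F n x - F m x\<bar> - e)\<^sup>2" by simp
        then show "norm (F n x - F m x) \<le> e / 2 + (F n x - F m x)\<^sup>2 / (2 * e)"
          using e by (simp add: power2_diff field_simps power2_eq_square)
      qed (use diff[OF that] in auto)
      also have "\<dots> = e / 2 + (c n - c m) / (2 * e)"
        using diff[OF that] by (simp add: prob_space)
      finally show ?thesis .
    qed
    show ?thesis
    proof (cases "i \<le> j")
      case True
      then have "\<bar>c i - c j\<bar> = c j - c i" using incseqD[OF \<open>incseq c\<close> True] by simp
      then show ?thesis using *[OF True] by (simp add: abs_minus_commute[of "F i _"])
    next
      case False
      then show ?thesis using *[of j i] \<open>incseq c\<close>[unfolded incseq_def, rule_format, of j i] by simp
    qed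
  qed
  have cau: "\<exists>N. \<forall>i\<ge>N. \<forall>j\<ge>N. (\<integral>x. norm (F i x - F j x) \<partial>M) < e" if e: "e > 0" for e
  proof -
    \<comment> \<open>The threshold \<open>e * e\<close> makes the second term of the L1 estimate
      smaller than \<open>e / 2\<close>.\<close>
    obtain N where N: "\<And>i j. i \<ge> N \<Longrightarrow> j \<ge> N \<Longrightarrow> \<bar>c i - c j\<bar> < e * e"
      using \<open>Cauchy c\<close> e unfolding Cauchy_def dist_real_def by (meson mult_pos_pos)
    have "(\<integral>x. norm (F i x - F j x) \<partial>M) < e" if "i \<ge> N" "j \<ge> N" for i j
    proof -
      have "\<bar>c i - c j\<bar> / (2 * e) < e / 2" using N[OF that] e by (simp add: field_simps)
      with L1[OF e, of i j] show ?thesis by simp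
    qed
    then show ?thesis by blast
  qed
  obtain r where r: "strict_mono r" "AE x in M. Cauchy (\<lambda>i. F (r i) x)"
    by (rule cauchy_L1_AE_cauchy_subseq[OF FI cau])
  define G where "G i = F (r i)" for i
  have [measurable]: "G i \<in> borel_measurable M" for i by (simp add: G_def)
  \<comment> \<open>The truncation makes \<open>f\<close> nonnegative everywhere, including the null
    set where \<open>lim\<close> is an arbitrary value; elsewhere it changes nothing.\<close>
  define f where "f x = max 0 (lim (\<lambda>i. G i x))" for x
  have fm[measurable]: "f \<in> borel_measurable M" unfolding f_def by measurable
  have f0: "0 \<le> f x" for x by (simp add: f_def)
  have AEf: "AE x in M. (\<lambda>i. G i x) \<longlonglongrightarrow> f x"
    using r(2)
  proof eventually_elim
    case (elim x)
    then have l: "(\<lambda>i. G i x) \<longlonglongrightarrow> lim (\<lambda>i. G i x)"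
      by (simp add: G_def Cauchy_convergent_iff convergent_LIMSEQ_iff)
    moreover have "0 \<le> lim (\<lambda>i. G i x)"
      by (rule LIMSEQ_le_const[OF l]) (auto simp: G_def nn)
    ultimately show ?case by (simp add: f_def)
  qed
  have fsq: "(\<integral>\<^sup>+x. ennreal ((f x)\<^sup>2) \<partial>M) \<le> ennreal C"
  proof -
    have "(\<integral>\<^sup>+x. ennreal ((f x)\<^sup>2) \<partial>M) = (\<integral>\<^sup>+x. liminf (\<lambda>i. ennreal ((G i x)\<^sup>2)) \<partial>M)"
    proof (rule nn_integral_cong_AE, use AEf in eventually_elim)
      case (elim x)
      then have "(\<lambda>i. ennreal ((G i x)\<^sup>2)) \<longlonglongrightarrow> ennreal ((f x)\<^sup>2)"
        by (intro tendsto_intros) 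
      then show ?case using lim_imp_Liminf[of sequentially] by fastforce
    qed
    also have "\<dots> \<le> liminf (\<lambda>i. \<integral>\<^sup>+x. ennreal ((G i x)\<^sup>2) \<partial>M)"
      by (rule nn_integral_liminf) simp
    also have "\<dots> \<le> liminf (\<lambda>i::nat. ennreal C)"
      using inner[of "r _" "r _"] cC
      by (intro Liminf_mono always_eventually allI) (simp add: G_def power2_eq_square ennreal_leI)
    finally show ?thesis by (simp add: Liminf_const)
  qed
  note fi = integrable_of_square_bound(2)[OF fm fsq]
  have GL1: "\<exists>N. \<forall>i\<ge>N. (\<integral>\<^sup>+x. ennreal \<bar>G i x - f x\<bar> \<partial>M) \<le> ennreal e" if "e > 0" for e
  proof -
    obtain N where N: "\<And>i j. i \<ge> N \<Longrightarrow> j \<ge> N \<Longrightarrow> (\<integral>x. norm (F i x - F j x) \<partial>M) < e"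
      using cau[OF \<open>e > 0\<close>] by blast
    have "(\<integral>\<^sup>+x. ennreal \<bar>G i x - f x\<bar> \<partial>M) \<le> ennreal e" if "i \<ge> N" for i
    proof -
      \<comment> \<open>With \<open>i\<close> fixed, Fatou's lemma in \<open>k\<close> carries the
        Cauchy estimate over to the limit.\<close>
      have "(\<integral>\<^sup>+x. ennreal \<bar>G i x - f x\<bar> \<partial>M) = (\<integral>\<^sup>+x. liminf (\<lambda>k. ennreal \<bar>G i x - G k x\<bar>) \<partial>M)"
      proof (rule nn_integral_cong_AE, use AEf in eventually_elim)
        case (elim x)
        then have "(\<lambda>k. ennreal \<bar>G i x - G k x\<bar>) \<longlonglongrightarrow> ennreal \<bar>G i x - f x\<bar>"
          by (intro tendsto_intros) 
        then show ?case using lim_imp_Liminf[of sequentially] by fastforce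
      qed
      also have "\<dots> \<le> liminf (\<lambda>k. \<integral>\<^sup>+x. ennreal \<bar>G i x - G k x\<bar> \<partial>M)"
        by (rule nn_integral_liminf) simp
      also have "\<dots> \<le> liminf (\<lambda>k::nat. ennreal e)"
      proof (rule Liminf_mono, rule eventually_sequentiallyI[of N])
        fix k assume "k \<ge> N"
        then have "r i \<ge> N" "r k \<ge> N" using \<open>i \<ge> N\<close> seq_suble[OF r(1)] le_trans by blast+
        from N[OF this] have "(\<integral>x. \<bar>G i x - G k x\<bar> \<partial>M) \<le> e" by (simp add: G_def)
        moreover have "integrable M (\<lambda>x. \<bar>G i x - G k x\<bar>)" by (simp add: G_def)
        ultimately show "(\<integral>\<^sup>+x. ennreal \<bar>G i x - G k x\<bar> \<partial>M) \<le> ennreal e"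
          by (subst nn_integral_eq_integral) (auto intro: ennreal_leI)
      qed
      finally show ?thesis by (simp add: Liminf_const)
    qed
    then show ?thesis by blast
  qed
  have conv: "(\<lambda>i. \<integral>\<^sup>+x. ennreal (F (r i) x) * indicator A x \<partial>M)
        \<longlonglongrightarrow> (\<integral>\<^sup>+x. ennreal (f x) * indicator A x \<partial>M)" if A[measurable]: "A \<in> sets M" for A
  proof -
    have ei: "(\<integral>\<^sup>+x. ennreal (h x) * indicator A x \<partial>M) = ennreal (\<integral>x. h x * indicator A x \<partial>M)"
      if "integrable M h" "\<And>x. 0 \<le> h x" for h :: "'a \<Rightarrow> real"
      using that A by (subst nn_integral_eq_integral[symmetric])
        (auto intro!: integrable_real_mult_indicator nn_integral_cong split: split_indicator)
    have "(\<lambda>i. \<integral>x. G i x * indicator A x \<partial>M) \<longlonglongrightarrow> (\<integral>x. f x * indicator A x \<partial>M)"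
    proof (rule LIMSEQ_I)
      fix e :: real assume "e > 0"
      then obtain N where N: "\<And>i. i \<ge> N \<Longrightarrow> (\<integral>\<^sup>+x. ennreal \<bar>G i x - f x\<bar> \<partial>M) \<le> ennreal (e/2)"
        using GL1[of "e/2"] by auto
      have "norm ((\<integral>x. G i x * indicator A x \<partial>M) - (\<integral>x. f x * indicator A x \<partial>M)) < e" if "i \<ge> N" for i
      proof -
        have Gi: "integrable M (G i)" by (simp add: G_def)
        have iA: "integrable M (\<lambda>x. G i x * indicator A x)" "integrable M (\<lambda>x. f x * indicator A x)"
          using Gi fi A by (auto intro: integrable_real_mult_indicator)
        have "norm ((\<integral>x. G i x * indicator A x \<partial>M) - (\<integral>x. f x * indicator A x \<partial>M))
            = norm (\<integral>x. G i x * indicator A x - f x * indicator A x \<partial>M)"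
          using iA by simp
        also have "\<dots> \<le> (\<integral>x. norm (G i x * indicator A x - f x * indicator A x) \<partial>M)"
          by (rule integral_norm_bound)
        also have "\<dots> \<le> (\<integral>x. \<bar>G i x - f x\<bar> \<partial>M)"
          using iA Gi fi by (intro integral_mono) (auto split: split_indicator)
        also have "\<dots> \<le> e / 2"
        proof -
          have "ennreal (\<integral>x. \<bar>G i x - f x\<bar> \<partial>M) \<le> ennreal (e/2)"
            using N[OF that] Gi fi by (subst nn_integral_eq_integral[symmetric]) auto
          then show ?thesis using \<open>e > 0\<close> by (simp add: ennreal_le_iff)
        qed
        finally show ?thesis using \<open>e > 0\<close> by simp
      qed
      then show "\<exists>N. \<forall>i\<ge>N. norm ((\<integral>x. G i x * indicator A x \<partial>M) - (\<integral>x. f x * indicator A x \<partial>M)) < e" by blast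
    qed
    then have "(\<lambda>i. ennreal (\<integral>x. G i x * indicator A x \<partial>M)) \<longlonglongrightarrow> ennreal (\<integral>x. f x * indicator A x \<partial>M)"
      by (rule tendsto_ennrealI)
    moreover have "(\<integral>\<^sup>+x. ennreal (G i x) * indicator A x \<partial>M) = ennreal (\<integral>x. G i x * indicator A x \<partial>M)" for i
      by (rule ei) (auto simp: G_def nn)
    ultimately show ?thesis using ei[OF fi f0] by (simp add: G_def)
  qed
  show ?thesis by (rule that[OF fm f0 r(1) fsq conv])
qed

section \<open>Logarithmic sums under a power law\<close>

text \<open>Comparison of the sum with the integral of \<open>x powr (-q)\<close>, one unit interval
  at a time by the mean value theorem. The term in \<open>N\<close> is kept in the bound so that the
  induction telescopes.\<close>

lemma sum_powr_tail_le:
  fixes q :: real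
  assumes q: "q > 1" and "m \<ge> 1" and "m \<le> N"
  shows "(\<Sum>j=Suc m..N. real j powr (-q)) \<le> (real m powr (1 - q) - real N powr (1 - q)) / (q - 1)"
  using \<open>m \<le> N\<close>
proof (induction N rule: dec_induct)
  case (step N)
  have "N \<ge> 1" using step \<open>m \<ge> 1\<close> by simp
  have "\<exists>z. real N < z \<and> z < real (Suc N) \<and>
    real (Suc N) powr (1 - q) - real N powr (1 - q) = (real (Suc N) - real N) * ((1 - q) * z powr (-q))"
  proof (rule MVT2)
    fix x assume "real N \<le> x"
    then have "x > 0" using \<open>N \<ge> 1\<close> by simp
    then show "((\<lambda>x. x powr (1 - q)) has_real_derivative (1 - q) * x powr (-q)) (at x)"
      by (auto intro!: derivative_eq_intros)
  qed simp
  then obtain z where z: "real N < z" "z < real (Suc N)"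
    "real (Suc N) powr (1 - q) - real N powr (1 - q) = (1 - q) * z powr (-q)" by auto
  have "real (Suc N) powr (-q) \<le> z powr (-q)"
    using z q \<open>N \<ge> 1\<close> by (intro powr_mono2') auto
  then have "(q - 1) * real (Suc N) powr (-q) \<le> (q - 1) * z powr (-q)"
    using q by (intro mult_left_mono) auto
  also have "\<dots> = real N powr (1 - q) - real (Suc N) powr (1 - q)"
    using z(3) by (simp add: algebra_simps)
  finally have "real (Suc N) powr (-q) \<le> (real N powr (1 - q) - real (Suc N) powr (1 - q)) / (q - 1)"
    using q by (simp add: field_simps)
  moreover have "(\<Sum>j=Suc m..Suc N. real j powr (-q)) = (\<Sum>j=Suc m..N. real j powr (-q)) + real (Suc N) powr (-q)"
    using step by simp
  ultimately have "(\<Sum>j=Suc m..Suc N. real j powr (-q)) \<le>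
      (real m powr (1 - q) - real N powr (1 - q)) / (q - 1) + (real N powr (1 - q) - real (Suc N) powr (1 - q)) / (q - 1)"
    using step.IH by linarith
  then show ?case by (simp add: diff_divide_distrib)
qed simp

text \<open>Each term is at most the increment of \<open>2 * sqrt\<close>, which amounts to
  \<open>sqrt (m * (m + 1)) \<le> m + 1/2\<close>.\<close>

lemma sum_inverse_sqrt_le: "(\<Sum>j=1..m. 1 / sqrt (real j)) \<le> 2 * sqrt (real m)"
proof (induction m)
  case (Suc m)
  have "sqrt (real (Suc m)) * sqrt (real m) \<le> real m + 1/2"
  proof -
    have "sqrt (real (Suc m)) * sqrt (real m) = sqrt (real (Suc m) * real m)" by (simp add: real_sqrt_mult)
    also have "\<dots> \<le> sqrt ((real m + 1/2)\<^sup>2)"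
      by (intro real_sqrt_le_mono) (simp add: power2_eq_square algebra_simps)
    finally show ?thesis by simp
  qed
  then have "1 / sqrt (real (Suc m)) + 2 * sqrt (real m) \<le> 2 * sqrt (real (Suc m))"
    by (simp add: field_simps)
  with Suc show ?case by simp
qed simp

text \<open>The sum is cut at \<open>m\<close>, the integer part of \<open>x = n powr (1/q)\<close>,
  because \<open>n * a j\<close> is of order \<open>(x / j) powr q\<close>. Up to \<open>m\<close>
  every term is at least \<open>ln (1 + c1)\<close>, and from above it grows only logarithmically in
  \<open>x / j\<close>, so that both bounds are of order \<open>x\<close>. Beyond \<open>m\<close>,
  \<open>ln (1 + y) \<le> y\<close> and the tail of the power series contribute order
  \<open>n * x powr (1 - q) = x\<close>. The constants are chosen before \<open>a\<close> and
  \<open>n\<close>, hence uniform in both.\<close>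

lemma sum_ln_one_plus_bounds:
  fixes q c1 c2 :: real
  assumes q: "q > 1" and c1: "0 < c1" and c12: "c1 \<le> c2"
  shows "\<exists>K>0. \<exists>L>0. \<forall>a. (\<forall>j\<ge>1. c1 * real j powr (-q) \<le> a j \<and> a j \<le> c2 * real j powr (-q)) \<longrightarrow>
    (\<forall>n\<ge>1. (\<forall>N. (\<Sum>j=1..N. ln (1 + real n * a j)) \<le> K * real n powr (1 / q)) \<and>
       (\<exists>N. L * real n powr (1 / q) \<le> (\<Sum>j=1..N. ln (1 + real n * a j))))"
proof -
  \<comment> \<open>\<open>B\<close> bounds \<open>ln ((1 + c2) * u powr q) / sqrt u\<close> for
    \<open>u \<ge> 1\<close>. In \<open>K\<close> the summand \<open>2 * B\<close> pays for the head
    and the other one for the tail. The half in \<open>L\<close> comes from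
    \<open>x / 2 \<le> m\<close>.\<close>
  define B where "B = ln (1 + c2) + 2 * q"
  define K where "K = 2 * B + c2 * 2 powr (q - 1) / (q - 1)"
  define L where "L = ln (1 + c1) / 2"
  have c2: "c2 > 0" using c1 c12 by simp
  have "ln (1 + c2) > 0" using c2 by simp
  then have B: "B > 0" using q by (simp add: B_def)
  have K: "K > 0" using B c2 q by (simp add: K_def add_pos_nonneg)
  have L: "L > 0" using c1 by (simp add: L_def)
  have main: "(\<Sum>j=1..N. ln (1 + real n * a j)) \<le> K * real n powr (1 / q)"
      "\<exists>N. L * real n powr (1 / q) \<le> (\<Sum>j=1..N. ln (1 + real n * a j))"
    if a: "\<And>j. j \<ge> 1 \<Longrightarrow> c1 * real j powr (-q) \<le> a j" "\<And>j. j \<ge> 1 \<Longrightarrow> a j \<le> c2 * real j powr (-q)"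
      and n: "n \<ge> 1" for a and n N :: nat
  proof -
    define x where "x = real n powr (1 / q)"
    have x1: "x \<ge> 1" using n q by (simp add: x_def ge_one_powr_ge_zero)
    have xq: "x powr q = real n" using n q by (simp add: x_def powr_powr)
    define m where "m = nat \<lfloor>x\<rfloor>"
    have m: "m \<ge> 1" "real m \<le> x" "x < real m + 1"
      using x1 by (auto simp: m_def le_nat_iff le_floor_iff)
    \<comment> \<open>Since \<open>m \<ge> 1\<close>, \<open>x < m + 1 \<le> 2 * m\<close>.\<close>
    have mx: "x / 2 \<le> real m" using m by simp
    have a0: "0 \<le> a j" if "j \<ge> 1" for j
      using order_trans[OF _ a(1)[OF that]] c1 by simp
    have na: "real n * a j \<le> c2 * (x / real j) powr q" "c1 * (x / real j) powr q \<le> real n * a j" if "j \<ge> 1" for j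
    proof -
      have "(x / real j) powr q = real n * real j powr (-q)"
        using that x1 by (simp add: powr_divide xq powr_minus_divide)
      then show "real n * a j \<le> c2 * (x / real j) powr q" "c1 * (x / real j) powr q \<le> real n * a j"
        using mult_left_mono[OF a(2)[OF that], of "real n"] mult_left_mono[OF a(1)[OF that], of "real n"]
        by (simp_all add: mult_ac)
    qed
    show "\<exists>N. L * real n powr (1 / q) \<le> (\<Sum>j=1..N. ln (1 + real n * a j))"
    proof (intro exI[of _ m])
      have "L * x \<le> real m * ln (1 + c1)"
        using mult_right_mono[OF mx, of "ln (1 + c1)"] c1 by (simp add: L_def mult_ac)
      also have "\<dots> = (\<Sum>j=1..m. ln (1 + c1))" by simp
      also have "\<dots> \<le> (\<Sum>j=1..m. ln (1 + real n * a j))"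
      proof (rule sum_mono)
        fix j assume j: "j \<in> {1..m}"
        then have "x / real j \<ge> 1" using m by (auto simp: field_simps)
        then have "(x / real j) powr q \<ge> 1" using q by (simp add: ge_one_powr_ge_zero)
        then have "c1 \<le> c1 * (x / real j) powr q" using c1 by simp
        also have "\<dots> \<le> real n * a j" using na j by simp
        finally show "ln (1 + c1) \<le> ln (1 + real n * a j)" using c1 by simp
      qed
      finally show "L * real n powr (1 / q) \<le> (\<Sum>j=1..m. ln (1 + real n * a j))" by (simp add: x_def)
    qed
    have head: "ln (1 + real n * a j) \<le> B * sqrt x * (1 / sqrt (real j))" if j: "j \<ge> 1" "j \<le> m" for j
    proof -
      define u where "u = x / real j"
      have u: "u \<ge> 1" using j m by (auto simp: u_def field_simps)
      have uq: "u powr q \<ge> 1" using u q by (simp add: ge_one_powr_ge_zero)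
      have su: "sqrt u \<ge> 1" using u by simp
      have "ln (1 + real n * a j) \<le> ln ((1 + c2) * u powr q)"
      proof (rule ln_mono)
        show "1 + real n * a j \<le> (1 + c2) * u powr q"
          using na(1)[OF j(1)] uq by (simp add: u_def algebra_simps)
      qed (use a0[OF j(1)] in \<open>simp add: add_pos_nonneg\<close>)
      also have "\<dots> = ln (1 + c2) + q * ln u"
        using c2 u by (simp add: ln_mult ln_powr)
      \<comment> \<open>The logarithm is traded for a square root: the sum of
        \<open>sqrt (x / j)\<close> over \<open>j \<le> m\<close> is still of order
        \<open>x\<close>.\<close>
      also have "ln u = 2 * ln (sqrt u)" using u by (simp add: ln_sqrt)
      also have "ln (sqrt u) \<le> sqrt u" using su ln_le_minus_one[of "sqrt u"] by simp
      also have "ln (1 + c2) \<le> ln (1 + c2) * sqrt u" using su c2 by simp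
      finally have "ln (1 + real n * a j) \<le> B * sqrt u" using q by (simp add: B_def algebra_simps)
      then show ?thesis by (simp add: u_def real_sqrt_divide)
    qed
    have headsum: "(\<Sum>j=1..k. ln (1 + real n * a j)) \<le> 2 * B * x" if "k \<le> m" for k
    proof -
      have "(\<Sum>j=1..k. ln (1 + real n * a j)) \<le> (\<Sum>j=1..k. B * sqrt x * (1 / sqrt (real j)))"
        using that by (intro sum_mono head) auto
      also have "\<dots> = B * sqrt x * (\<Sum>j=1..k. 1 / sqrt (real j))" by (simp add: sum_distrib_left)
      also have "\<dots> \<le> B * sqrt x * (2 * sqrt (real k))"
        using B x1 by (intro mult_left_mono sum_inverse_sqrt_le) auto
      also have "\<dots> \<le> B * sqrt x * (2 * sqrt x)"
        using B x1 m that by (intro mult_left_mono) auto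
      also have "\<dots> = 2 * B * x" using x1 by simp
      finally show ?thesis .
    qed
    have K2: "c2 * 2 powr (q - 1) / (q - 1) \<ge> 0" using c2 q by simp
    have "(\<Sum>j=1..N. ln (1 + real n * a j)) \<le> K * x"
    proof (cases "N \<le> m")
      case True
      have "(\<Sum>j=1..N. ln (1 + real n * a j)) \<le> 2 * B * x" using True by (rule headsum)
      also have "\<dots> \<le> K * x" using K2 x1 by (intro mult_right_mono) (auto simp: K_def)
      finally show ?thesis .
    next
      case False
      then have mN: "m \<le> N" by simp
      have "(\<Sum>j=Suc m..N. ln (1 + real n * a j)) \<le> (\<Sum>j=Suc m..N. real n * c2 * real j powr (-q))"
      proof (rule sum_mono)
        fix j assume "j \<in> {Suc m..N}"
        then have j: "j \<ge> 1" by simp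
        have "ln (1 + real n * a j) \<le> real n * a j" using a0[OF j] by (intro ln_add_one_self_le_self) simp
        also have "\<dots> \<le> real n * c2 * real j powr (-q)"
          using mult_left_mono[OF a(2)[OF j], of "real n"] by (simp add: mult_ac)
        finally show "ln (1 + real n * a j) \<le> real n * c2 * real j powr (-q)" .
      qed
      also have "\<dots> = real n * c2 * (\<Sum>j=Suc m..N. real j powr (-q))" by (simp add: sum_distrib_left)
      also have "\<dots> \<le> real n * c2 * ((real m powr (1 - q) - real N powr (1 - q)) / (q - 1))"
        using c2 by (intro mult_left_mono sum_powr_tail_le q m mN) auto
      also have "\<dots> \<le> real n * c2 * ((x / 2) powr (1 - q) / (q - 1))"
      proof -
        have "real m powr (1 - q) \<le> (x / 2) powr (1 - q)"
          using mx x1 q by (intro powr_mono2') auto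
        then have "real m powr (1 - q) - real N powr (1 - q) \<le> (x / 2) powr (1 - q)"
          using powr_ge_zero[of "real N" "1 - q"] by linarith
        then show ?thesis using c2 q by (intro mult_left_mono divide_right_mono) auto
      qed
      also have "\<dots> = c2 * 2 powr (q - 1) / (q - 1) * x"
      proof -
        have "real n * (x / 2) powr (1 - q) = x powr q * (x powr (1 - q) * 2 powr (q - 1))"
          using x1 powr_minus_divide[of 2 "1 - q"] by (simp add: xq powr_divide)
        also have "\<dots> = x * 2 powr (q - 1)"
          using x1 by (simp flip: powr_add add: mult.assoc[symmetric])
        finally show ?thesis by (simp add: field_simps)
      qed
      finally have "(\<Sum>j=Suc m..N. ln (1 + real n * a j)) \<le> c2 * 2 powr (q - 1) / (q - 1) * x" .
      moreover have "(\<Sum>j=1..N. ln (1 + real n * a j)) =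
          (\<Sum>j=1..m. ln (1 + real n * a j)) + (\<Sum>j=Suc m..N. ln (1 + real n * a j))"
        using mN sum.ub_add_nat[of 1 m "\<lambda>j. ln (1 + real n * a j)" "N - m"] m by simp
      ultimately show ?thesis using headsum[of m] by (simp add: K_def algebra_simps)
    qed
    then show "(\<Sum>j=1..N. ln (1 + real n * a j)) \<le> K * real n powr (1 / q)" by (simp add: x_def)
  qed
  show ?thesis
  proof (rule exI[of _ K], rule conjI[OF K], rule exI[of _ L], rule conjI[OF L], intro allI impI conjI)
    fix a and n N :: nat
    assume a: "\<forall>j\<ge>1. c1 * real j powr (-q) \<le> a j \<and> a j \<le> c2 * real j powr (-q)" and n: "1 \<le> n"
    show "(\<Sum>j=1..N. ln (1 + real n * a j)) \<le> K * real n powr (1 / q)"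
      by (rule main(1)[OF _ _ n]) (use a in simp_all)
    show "\<exists>N. L * real n powr (1 / q) \<le> (\<Sum>j=1..N. ln (1 + real n * a j))"
      by (rule main(2)[OF _ _ n]) (use a in simp_all)
  qed
qed

section \<open>One Gaussian coordinate\<close>

lemma (in prob_space) normal_second_moment:
  assumes \<sigma>: "0 < \<sigma>" and X: "distributed M lborel X (normal_density 0 \<sigma>)"
  shows "integrable M (\<lambda>\<omega>. (X \<omega>)\<^sup>2)" and "expectation (\<lambda>\<omega>. (X \<omega>)\<^sup>2) = \<sigma>\<^sup>2"
proof -
  show "integrable M (\<lambda>\<omega>. (X \<omega>)\<^sup>2)"
    using integrable_normal_moment[OF \<sigma>, of 0 2]
    by (subst distributed_integrable[OF X, symmetric]) simp_all
  show "expectation (\<lambda>\<omega>. (X \<omega>)\<^sup>2) = \<sigma>\<^sup>2"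
    using integral_normal_moment_even[OF \<sigma>, of 0 1]
    by (subst distributed_integral[OF X, symmetric]) simp_all
qed

lemma ln_normal_density:
  assumes "0 < \<sigma>"
  shows "ln (normal_density \<mu> \<sigma> x) = - ln (sqrt (2 * pi)) - ln \<sigma> - (x - \<mu>)\<^sup>2 / (2 * \<sigma>\<^sup>2)"
proof -
  have "normal_density \<mu> \<sigma> x = exp (- (x - \<mu>)\<^sup>2 / (2 * \<sigma>\<^sup>2)) / (sqrt (2 * pi) * \<sigma>)"
    using assms by (simp add: normal_density_def real_sqrt_mult)
  then show ?thesis using assms by (simp add: ln_div ln_mult)
qed

section \<open>Gaussian integrals in closed form\<close>

lemma exp_quadratic_eq_normal_density:
  assumes "0 < \<sigma>"
  shows "exp (- (x - \<mu>)\<^sup>2 / (2 * \<sigma>\<^sup>2)) = sqrt (2 * pi * \<sigma>\<^sup>2) * normal_density \<mu> \<sigma> x"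
  using assms by (simp add: normal_density_def)

lemma nn_integral_exp_quadratic:
  assumes \<sigma>: "0 < \<sigma>" and c: "0 \<le> c"
  shows "(\<integral>\<^sup>+x. ennreal (c * exp (- (x - \<mu>)\<^sup>2 / (2 * \<sigma>\<^sup>2))) \<partial>lborel) = ennreal (c * sqrt (2 * pi * \<sigma>\<^sup>2))"
proof -
  have "(\<integral>\<^sup>+x. ennreal (c * exp (- (x - \<mu>)\<^sup>2 / (2 * \<sigma>\<^sup>2))) \<partial>lborel)
      = (\<integral>\<^sup>+x. ennreal (c * sqrt (2 * pi * \<sigma>\<^sup>2)) * ennreal (normal_density \<mu> \<sigma> x) \<partial>lborel)"
    unfolding exp_quadratic_eq_normal_density[OF \<sigma>] using c
    by (simp add: ennreal_mult' mult.assoc)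
  also have "\<dots> = ennreal (c * sqrt (2 * pi * \<sigma>\<^sup>2)) * (\<integral>\<^sup>+x. ennreal (normal_density \<mu> \<sigma> x) \<partial>lborel)"
    by (rule nn_integral_cmult) simp
  also have "(\<integral>\<^sup>+x. ennreal (normal_density \<mu> \<sigma> x) \<partial>lborel) = 1"
    using \<sigma> by (subst nn_integral_eq_integral) auto
  finally show ?thesis by simp
qed

text \<open>The exponential factor comes from completing the square in \<open>y\<close>.\<close>

lemma nn_integral_normal_density_square_over:
  assumes s: "0 < s" and w: "s \<le> w"
  shows "(\<integral>\<^sup>+y. ennreal (normal_density m s y * (normal_density m s y / normal_density 0 w y)) \<partial>lborel)
    = ennreal (w\<^sup>2 / (s * sqrt (2 * w\<^sup>2 - s\<^sup>2)) * exp (m\<^sup>2 / (2 * w\<^sup>2 - s\<^sup>2)))"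
proof -
  define d where "d = 2 * w\<^sup>2 - s\<^sup>2"
  have w0: "w > 0" using s w by simp
  have "s\<^sup>2 \<le> w\<^sup>2" using s w by (intro power_mono) auto
  moreover have "0 < w\<^sup>2" using w0 by simp
  ultimately have d: "d > 0" unfolding d_def by linarith
  \<comment> \<open>\<open>r\<close> is the standard deviation of the Gaussian in \<open>y\<close>
    left by the completed square: \<open>1 / r\<^sup>2 = 2 / s\<^sup>2 - 1 / w\<^sup>2\<close>,
    which is positive since \<open>s \<le> w\<close>. Its mean is
    \<open>2 * w\<^sup>2 * m / d\<close>.\<close>
  define r where "r = w * s / sqrt d"
  have r: "r > 0" using w0 s d by (simp add: r_def)
  have r2: "r\<^sup>2 = w\<^sup>2 * s\<^sup>2 / d" using d by (simp add: r_def power_divide power_mult_distrib)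
  define c where "c = w / (sqrt (2 * pi) * s\<^sup>2) * exp (m\<^sup>2 / d)"
  have c: "c \<ge> 0" using w0 by (simp add: c_def)
  have sq: "sqrt (2 * pi * u\<^sup>2) = sqrt (2 * pi) * u" if "u > 0" for u
    using that by (simp add: real_sqrt_mult)
  have eq: "normal_density m s y * (normal_density m s y / normal_density 0 w y)
      = c * exp (- (y - 2 * w\<^sup>2 * m / d)\<^sup>2 / (2 * r\<^sup>2))" for y
  proof -
    have ex: "- (y - m)\<^sup>2 / (2 * s\<^sup>2) + (- (y - m)\<^sup>2 / (2 * s\<^sup>2)) - (- y\<^sup>2 / (2 * w\<^sup>2)) =
        m\<^sup>2 / d + (- (y - 2 * w\<^sup>2 * m / d)\<^sup>2 / (2 * r\<^sup>2))"
    proof -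
      have "y - 2 * w\<^sup>2 * m / d = (d * y - 2 * w\<^sup>2 * m) / d"
        using d by (simp add: field_simps)
      then have "(y - 2 * w\<^sup>2 * m / d)\<^sup>2 / (2 * r\<^sup>2) = (d * y - 2 * w\<^sup>2 * m)\<^sup>2 / d\<^sup>2 / (2 * (w\<^sup>2 * s\<^sup>2 / d))"
        by (simp add: r2 power_divide)
      moreover have "P / d\<^sup>2 / (2 * (W / d)) = P / (2 * W * d)" for P W :: real
        using d by (simp add: power2_eq_square)
      ultimately have "(y - 2 * w\<^sup>2 * m / d)\<^sup>2 / (2 * r\<^sup>2) = (d * y - 2 * w\<^sup>2 * m)\<^sup>2 / (2 * w\<^sup>2 * s\<^sup>2 * d)"
        by (simp add: mult.assoc)
      have "m\<^sup>2 / d + (- (y - 2 * w\<^sup>2 * m / d)\<^sup>2 / (2 * r\<^sup>2)) = m\<^sup>2 / d - (d * y - 2 * w\<^sup>2 * m)\<^sup>2 / (2 * w\<^sup>2 * s\<^sup>2 * d)"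
        using \<open>(y - 2 * w\<^sup>2 * m / d)\<^sup>2 / (2 * r\<^sup>2) = (d * y - 2 * w\<^sup>2 * m)\<^sup>2 / (2 * w\<^sup>2 * s\<^sup>2 * d)\<close> by simp
      also have "\<dots> = (2 * w\<^sup>2 * s\<^sup>2 * m\<^sup>2 - (d * y - 2 * w\<^sup>2 * m)\<^sup>2) / (2 * w\<^sup>2 * s\<^sup>2 * d)"
        using d w0 s by (simp add: field_simps)
      \<comment> \<open>With \<open>d = 2 * w\<^sup>2 - s\<^sup>2\<close> substituted this is a
        polynomial identity, and the factor \<open>d\<close> it exposes cancels against the
        denominator.\<close>
      also have "2 * w\<^sup>2 * s\<^sup>2 * m\<^sup>2 - (d * y - 2 * w\<^sup>2 * m)\<^sup>2 = d * (s\<^sup>2 * y\<^sup>2 - 2 * w\<^sup>2 * (y - m)\<^sup>2)"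
        unfolding d_def by algebra
      also have "d * (s\<^sup>2 * y\<^sup>2 - 2 * w\<^sup>2 * (y - m)\<^sup>2) / (2 * w\<^sup>2 * s\<^sup>2 * d) =
          (s\<^sup>2 * y\<^sup>2 - 2 * w\<^sup>2 * (y - m)\<^sup>2) / (2 * w\<^sup>2 * s\<^sup>2)" using d by simp
      also have "\<dots> = y\<^sup>2 / (2 * w\<^sup>2) - (y - m)\<^sup>2 / s\<^sup>2" using w0 s by (simp add: field_simps)
      finally show ?thesis by simp
    qed
    have "normal_density m s y * (normal_density m s y / normal_density 0 w y) =
        (sqrt (2 * pi * w\<^sup>2) / (sqrt (2 * pi * s\<^sup>2) * sqrt (2 * pi * s\<^sup>2))) *
        (exp (- (y - m)\<^sup>2 / (2 * s\<^sup>2)) * exp (- (y - m)\<^sup>2 / (2 * s\<^sup>2)) / exp (- y\<^sup>2 / (2 * w\<^sup>2)))"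
    proof -
      have "(1 / S * E) * ((1 / S * E) / (1 / W * F)) = (W / (S * S)) * (E * E / F)" for S E W F :: real
        by (simp add: mult_ac)
      then show ?thesis unfolding normal_density_def diff_zero .
    qed
    also have "exp (- (y - m)\<^sup>2 / (2 * s\<^sup>2)) * exp (- (y - m)\<^sup>2 / (2 * s\<^sup>2)) / exp (- y\<^sup>2 / (2 * w\<^sup>2)) =
        exp (m\<^sup>2 / d) * exp (- (y - 2 * w\<^sup>2 * m / d)\<^sup>2 / (2 * r\<^sup>2))"
      unfolding exp_add[symmetric] exp_diff[symmetric] ex ..
    also have "sqrt (2 * pi * w\<^sup>2) / (sqrt (2 * pi * s\<^sup>2) * sqrt (2 * pi * s\<^sup>2)) = w / (sqrt (2 * pi) * s\<^sup>2)"
      unfolding sq[OF w0] sq[OF s] by (simp add: power2_eq_square)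
    finally show ?thesis by (simp add: c_def)
  qed
  have "(\<integral>\<^sup>+y. ennreal (normal_density m s y * (normal_density m s y / normal_density 0 w y)) \<partial>lborel)
      = ennreal (c * sqrt (2 * pi * r\<^sup>2))"
    unfolding eq by (rule nn_integral_exp_quadratic[OF r c])
  also have "c * sqrt (2 * pi * r\<^sup>2) = w\<^sup>2 / (s * sqrt d) * exp (m\<^sup>2 / d)"
    unfolding sq[OF r] unfolding c_def r_def using s d by (simp add: power2_eq_square)
  finally show ?thesis by (simp add: d_def)
qed

text \<open>The outer integral of the second moment computation, over the prior. It is finite
  because the prior dominates the exponential factor: \<open>1 / \<tau>\<^sup>2 - 2 *
  \<kappa>\<^sup>2 / d = s\<^sup>2 / (\<tau>\<^sup>2 * d)\<close>, which is
  \<open>1 / r\<^sup>2\<close> for the \<open>r\<close> of the proof.\<close>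

lemma nn_integral_normal_density_exp_square:
  fixes \<kappa> \<tau> s c :: real
  assumes \<tau>: "0 < \<tau>" and s: "0 < s"
  defines "d \<equiv> 2 * (\<kappa>\<^sup>2 * \<tau>\<^sup>2) + s\<^sup>2"
  assumes c: "0 \<le> c"
  shows "(\<integral>\<^sup>+x. ennreal (normal_density 0 \<tau> x * (c * exp ((\<kappa> * x)\<^sup>2 / d))) \<partial>lborel) = ennreal (c * sqrt d / s)"
proof -
  have d: "d > 0" using s by (simp add: d_def add_nonneg_pos)
  define r where "r = \<tau> * sqrt d / s"
  have r: "r > 0" using \<tau> s d by (simp add: r_def)
  have r2: "r\<^sup>2 = \<tau>\<^sup>2 * d / s\<^sup>2" using d by (simp add: r_def power_divide power_mult_distrib)
  have eq: "normal_density 0 \<tau> x * (c * exp ((\<kappa> * x)\<^sup>2 / d)) =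
      c / sqrt (2 * pi * \<tau>\<^sup>2) * exp (- (x - 0)\<^sup>2 / (2 * r\<^sup>2))" for x
  proof -
    have "- x\<^sup>2 / (2 * \<tau>\<^sup>2) + (\<kappa> * x)\<^sup>2 / d = (2 * (\<kappa>\<^sup>2 * \<tau>\<^sup>2) - d) * x\<^sup>2 / (2 * \<tau>\<^sup>2 * d)"
      using \<tau> d by (simp add: field_simps power_mult_distrib)
    also have "2 * (\<kappa>\<^sup>2 * \<tau>\<^sup>2) - d = - s\<^sup>2" by (simp add: d_def)
    also have "- s\<^sup>2 * x\<^sup>2 / (2 * \<tau>\<^sup>2 * d) = - (x - 0)\<^sup>2 / (2 * r\<^sup>2)"
      using \<tau> d s by (simp add: r2 mult_ac)
    finally show ?thesis
      by (simp add: normal_density_def exp_add[symmetric])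
  qed
  have "(\<integral>\<^sup>+x. ennreal (normal_density 0 \<tau> x * (c * exp ((\<kappa> * x)\<^sup>2 / d))) \<partial>lborel) =
      ennreal (c / sqrt (2 * pi * \<tau>\<^sup>2) * sqrt (2 * pi * r\<^sup>2))"
    unfolding eq using c by (intro nn_integral_exp_quadratic[OF r]) simp
  also have "c / sqrt (2 * pi * \<tau>\<^sup>2) * sqrt (2 * pi * r\<^sup>2) = c * sqrt d / s"
    using \<tau> s d by (simp add: r_def real_sqrt_mult)
  finally show ?thesis .
qed

text \<open>The conditional density of the observation given the parameter, divided by its marginal
  density. The prior density has cancelled from the quotient of joint density and product density.
  \<open>s\<close> is the noise level and \<open>w\<close> the marginal standard deviation.\<close>

definition gaussian_likelihood_ratio :: "real \<Rightarrow> real \<Rightarrow> real \<Rightarrow> real \<times> real \<Rightarrow> real" where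
  "gaussian_likelihood_ratio k s w z = normal_density (k * fst z) s (snd z) / normal_density 0 w (snd z)"

lemma gaussian_likelihood_ratio_pos: "0 < s \<Longrightarrow> 0 < w \<Longrightarrow> 0 < gaussian_likelihood_ratio k s w z"
  by (simp add: gaussian_likelihood_ratio_def normal_density_pos)

lemma measurable_normal_density_pair [measurable]:
  "(\<lambda>z. normal_density (k * fst z) s (snd z)) \<in> borel_measurable (borel \<Otimes>\<^sub>M borel)"
  unfolding normal_density_def by measurable

lemma measurable_gaussian_likelihood_ratio [measurable]:
  "gaussian_likelihood_ratio k s w \<in> borel_measurable (borel \<Otimes>\<^sub>M borel)"
  unfolding gaussian_likelihood_ratio_def[abs_def] by measurable

text \<open>The second claim is the second moment of the ratio under the product of the marginals,
  since one factor of the ratio turns that product into the joint law. The last one is the mutual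
  information of a single pair: the logarithm of the ratio is \<open>ln (w / s)\<close> plus two
  quadratic terms in the noise and the observation, whose means cancel.\<close>

lemma (in prob_space)
  fixes \<theta> \<epsilon> :: "'a \<Rightarrow> real" and k t \<tau> \<sigma> :: real
  assumes pos: "0 < k" "0 < t" "0 < \<tau>" "0 < \<sigma>"
    and \<theta>: "distributed M lborel \<theta> (normal_density 0 \<tau>)"
    and \<epsilon>: "distributed M lborel \<epsilon> (normal_density 0 \<sigma>)"
    and indep: "indep_var borel \<theta> borel \<epsilon>"
  defines "Y \<equiv> \<lambda>\<omega>. k * \<theta> \<omega> + t * \<epsilon> \<omega>"
    and "s \<equiv> t * \<sigma>"
    and "w \<equiv> sqrt (k\<^sup>2 * \<tau>\<^sup>2 + (t * \<sigma>)\<^sup>2)"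
  shows gaussian_pair_law: "distr M (borel \<Otimes>\<^sub>M borel) (\<lambda>\<omega>. (\<theta> \<omega>, Y \<omega>)) =
      density (distr M borel \<theta> \<Otimes>\<^sub>M distr M borel Y) (\<lambda>z. ennreal (gaussian_likelihood_ratio k s w z))"
    and nn_expectation_gaussian_likelihood_ratio:
      "(\<integral>\<^sup>+\<omega>. ennreal (gaussian_likelihood_ratio k s w (\<theta> \<omega>, Y \<omega>)) \<partial>M) = ennreal (1 + k\<^sup>2 * \<tau>\<^sup>2 / s\<^sup>2)"
    and integrable_ln_gaussian_likelihood_ratio:
      "integrable M (\<lambda>\<omega>. ln (gaussian_likelihood_ratio k s w (\<theta> \<omega>, Y \<omega>)))"
    and expectation_ln_gaussian_likelihood_ratio:
      "expectation (\<lambda>\<omega>. ln (gaussian_likelihood_ratio k s w (\<theta> \<omega>, Y \<omega>))) = ln (1 + k\<^sup>2 * \<tau>\<^sup>2 / s\<^sup>2) / 2"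
proof -
  have s: "s > 0" using pos by (simp add: s_def)
  have w2: "w\<^sup>2 = k\<^sup>2 * \<tau>\<^sup>2 + s\<^sup>2" using pos by (simp add: w_def s_def)
  have w: "w > 0" using pos by (simp add: w_def add_nonneg_pos)
  have sw: "s \<le> w" by (rule power2_le_imp_le) (use w in \<open>simp_all add: w2\<close>)
  have m\<theta>[measurable]: "random_variable borel \<theta>" using \<theta> by (simp add: distributed_def)
  have m\<epsilon>[measurable]: "random_variable borel \<epsilon>" using \<epsilon> by (simp add: distributed_def)
  have mY[measurable]: "random_variable borel Y" unfolding Y_def by measurable
  have Y: "distributed M lborel Y (normal_density 0 w)"
  proof -
    have "indep_var borel ((\<lambda>x. k * x) \<circ> \<theta>) borel ((\<lambda>x. t * x) \<circ> \<epsilon>)"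
      by (rule indep_var_compose[OF indep]) auto
    then have i: "indep_var borel (\<lambda>\<omega>. k * \<theta> \<omega>) borel (\<lambda>\<omega>. t * \<epsilon> \<omega>)" by (simp add: comp_def)
    have "distributed M lborel (\<lambda>\<omega>. k * \<theta> \<omega>) (normal_density 0 (k * \<tau>))"
      using normal_density_affine[OF \<theta>, of k 0] pos by simp
    moreover have "distributed M lborel (\<lambda>\<omega>. t * \<epsilon> \<omega>) (normal_density 0 (t * \<sigma>))"
      using normal_density_affine[OF \<epsilon>, of t 0] pos by simp
    ultimately have "distributed M lborel (\<lambda>\<omega>. k * \<theta> \<omega> + t * \<epsilon> \<omega>)
        (normal_density (0 + 0) (sqrt ((k * \<tau>)\<^sup>2 + (t * \<sigma>)\<^sup>2)))"
      using pos by (intro add_indep_normal[OF i]) auto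
    then show ?thesis by (simp add: Y_def w_def power_mult_distrib)
  qed
  \<comment> \<open>Disintegration of the joint law: given \<open>\<theta> = x\<close>, the
    observation is normal with mean \<open>k * x\<close> and deviation \<open>s\<close>. For fixed
    \<open>x\<close> this is the substitution \<open>y = k * x + t * e\<close>, whose Jacobian
    \<open>t\<close> cancels against the normalization of the density.\<close>
  have pair: "(\<integral>\<^sup>+\<omega>. h (\<theta> \<omega>, Y \<omega>) \<partial>M) =
      (\<integral>\<^sup>+x. ennreal (normal_density 0 \<tau> x) *
        (\<integral>\<^sup>+y. ennreal (normal_density (k * x) s y) * h (x, y) \<partial>lborel) \<partial>lborel)"
    if h[measurable]: "h \<in> borel_measurable (borel \<Otimes>\<^sub>M borel)" for h
  proof -
    have indl: "indep_var lborel \<theta> lborel \<epsilon>"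
      using indep by (simp add: indep_var_distribution_eq cong: distr_cong)
    have J: "distributed M (lborel \<Otimes>\<^sub>M lborel) (\<lambda>\<omega>. (\<theta> \<omega>, \<epsilon> \<omega>))
        (\<lambda>(x, e). ennreal (normal_density 0 \<tau> x) * ennreal (normal_density 0 \<sigma> e))"
      by (rule distributed_joint_indep[OF _ _ \<theta> \<epsilon> indl]) unfold_locales
    have m: "(\<lambda>(x, e). h (x, k * x + t * e)) \<in> borel_measurable (lborel \<Otimes>\<^sub>M lborel)"
      by measurable
    have "(\<integral>\<^sup>+\<omega>. h (\<theta> \<omega>, Y \<omega>) \<partial>M) =
        (\<integral>\<^sup>+z. (case z of (x, e) \<Rightarrow> ennreal (normal_density 0 \<tau> x) * ennreal (normal_density 0 \<sigma> e)) *
          (case z of (x, e) \<Rightarrow> h (x, k * x + t * e)) \<partial>(lborel \<Otimes>\<^sub>M lborel))"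
      unfolding distributed_nn_integral[OF J m] by (simp add: Y_def)
    also have "\<dots> = (\<integral>\<^sup>+x. \<integral>\<^sup>+e. (ennreal (normal_density 0 \<tau> x) * ennreal (normal_density 0 \<sigma> e)) *
          h (x, k * x + t * e) \<partial>lborel \<partial>lborel)"
      by (subst lborel.nn_integral_fst[symmetric]) simp_all
    also have "\<dots> = (\<integral>\<^sup>+x. ennreal (normal_density 0 \<tau> x) *
        (\<integral>\<^sup>+e. ennreal (normal_density 0 \<sigma> e) * h (x, k * x + t * e) \<partial>lborel) \<partial>lborel)"
      by (simp add: mult.assoc nn_integral_cmult)
    also have "\<dots> = (\<integral>\<^sup>+x. ennreal (normal_density 0 \<tau> x) *
        (\<integral>\<^sup>+y. ennreal (normal_density (k * x) s y) * h (x, y) \<partial>lborel) \<partial>lborel)"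
    proof (rule nn_integral_cong)
      fix x
      have e: "ennreal \<bar>t\<bar> * (ennreal (normal_density (k * x) s (k * x + t * e)) * h (x, k * x + t * e)) =
          ennreal (normal_density 0 \<sigma> e) * h (x, k * x + t * e)" for e
      proof -
        have "\<bar>t\<bar> * normal_density (k * x) s (k * x + t * e) = normal_density 0 \<sigma> e"
          using pos by (simp add: normal_density_def s_def power_mult_distrib real_sqrt_mult)
        then show ?thesis by (simp add: mult.assoc[symmetric] ennreal_mult'[symmetric])
      qed
      have "(\<integral>\<^sup>+y. ennreal (normal_density (k * x) s y) * h (x, y) \<partial>lborel) =
          (\<integral>\<^sup>+e. ennreal \<bar>t\<bar> * (ennreal (normal_density (k * x) s (k * x + t * e)) * h (x, k * x + t * e)) \<partial>lborel)"
        using pos by (subst nn_integral_real_affine[where c=t and t="k * x"]) (simp_all add: nn_integral_cmult)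
      then show "ennreal (normal_density 0 \<tau> x) *
          (\<integral>\<^sup>+e. ennreal (normal_density 0 \<sigma> e) * h (x, k * x + t * e) \<partial>lborel) =
          ennreal (normal_density 0 \<tau> x) * (\<integral>\<^sup>+y. ennreal (normal_density (k * x) s y) * h (x, y) \<partial>lborel)"
        unfolding e by simp
    qed
    finally show ?thesis .
  qed
  let ?g = "gaussian_likelihood_ratio k s w"
  show "distr M (borel \<Otimes>\<^sub>M borel) (\<lambda>\<omega>. (\<theta> \<omega>, Y \<omega>)) =
      density (distr M borel \<theta> \<Otimes>\<^sub>M distr M borel Y) (\<lambda>z. ennreal (?g z))" (is "?L = ?R")
  proof (rule measure_eqI)
    show "sets ?L = sets ?R" by (simp cong: sets_pair_measure_cong)
    fix A assume "A \<in> sets ?L"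
    then have A[measurable]: "A \<in> sets (borel \<Otimes>\<^sub>M borel)" by simp
    interpret PY: prob_space "distr M borel Y" by (rule prob_space_distr) simp
    have d\<theta>: "distr M borel \<theta> = density lborel (\<lambda>x. ennreal (normal_density 0 \<tau> x))"
      using distributed_distr_eq_density[OF \<theta>] by (simp cong: distr_cong)
    have dY: "distr M borel Y = density lborel (\<lambda>x. ennreal (normal_density 0 w x))"
      using distributed_distr_eq_density[OF Y] by (simp cong: distr_cong)
    have "emeasure ?L A = (\<integral>\<^sup>+z. indicator A z \<partial>?L)" by simp
    also have "\<dots> = (\<integral>\<^sup>+\<omega>. indicator A (\<theta> \<omega>, Y \<omega>) \<partial>M)"
      by (rule nn_integral_distr) simp_all
    also have "\<dots> = (\<integral>\<^sup>+x. ennreal (normal_density 0 \<tau> x) *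
        (\<integral>\<^sup>+y. ennreal (normal_density (k * x) s y) * indicator A (x, y) \<partial>lborel) \<partial>lborel)"
      by (rule pair) simp
    also have "\<dots> = (\<integral>\<^sup>+x. ennreal (normal_density 0 \<tau> x) *
        (\<integral>\<^sup>+y. ennreal (normal_density 0 w y) * (ennreal (?g (x, y)) * indicator A (x, y)) \<partial>lborel) \<partial>lborel)"
    proof -
      have "ennreal (normal_density (k * x) s y) = ennreal (normal_density 0 w y) * ennreal (?g (x, y))" for x y
        using normal_density_pos[OF w, of 0 y]
        by (simp add: gaussian_likelihood_ratio_def ennreal_mult'[symmetric])
      then show ?thesis by (simp add: mult.assoc)
    qed
    also have "\<dots> = (\<integral>\<^sup>+x. \<integral>\<^sup>+y. ennreal (?g (x, y)) * indicator A (x, y) \<partial>distr M borel Y \<partial>distr M borel \<theta>)"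
      unfolding d\<theta> dY by (simp add: nn_integral_density)
    also have "\<dots> = (\<integral>\<^sup>+z. ennreal (?g z) * indicator A z \<partial>(distr M borel \<theta> \<Otimes>\<^sub>M distr M borel Y))"
      by (rule PY.nn_integral_fst) simp
    also have "\<dots> = emeasure ?R A"
      by (subst emeasure_density) simp_all
    finally show "emeasure ?L A = emeasure ?R A" .
  qed
  show "(\<integral>\<^sup>+\<omega>. ennreal (?g (\<theta> \<omega>, Y \<omega>)) \<partial>M) = ennreal (1 + k\<^sup>2 * \<tau>\<^sup>2 / s\<^sup>2)"
  proof -
    define d where "d = 2 * (k\<^sup>2 * \<tau>\<^sup>2) + s\<^sup>2"
    have d: "d > 0" using s by (simp add: d_def add_nonneg_pos)
    have dw: "2 * w\<^sup>2 - s\<^sup>2 = d" by (simp add: w2 d_def)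
    define c where "c = w\<^sup>2 / (s * sqrt d)"
    have c: "c \<ge> 0" using s d by (simp add: c_def)
    have "(\<integral>\<^sup>+\<omega>. ennreal (?g (\<theta> \<omega>, Y \<omega>)) \<partial>M) =
      (\<integral>\<^sup>+x. ennreal (normal_density 0 \<tau> x) *
        (\<integral>\<^sup>+y. ennreal (normal_density (k * x) s y) * ennreal (?g (x, y)) \<partial>lborel) \<partial>lborel)"
      by (rule pair) simp
    also have "\<dots> = (\<integral>\<^sup>+x. ennreal (normal_density 0 \<tau> x) *
        (\<integral>\<^sup>+y. ennreal (normal_density (k * x) s y * (normal_density (k * x) s y / normal_density 0 w y)) \<partial>lborel) \<partial>lborel)"
      by (simp add: gaussian_likelihood_ratio_def flip: ennreal_mult')
    also have "\<dots> = (\<integral>\<^sup>+x. ennreal (normal_density 0 \<tau> x * (c * exp ((k * x)\<^sup>2 / d))) \<partial>lborel)"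
      unfolding nn_integral_normal_density_square_over[OF s sw] dw c_def by (simp flip: ennreal_mult')
    also have "\<dots> = ennreal (c * sqrt d / s)"
      unfolding d_def using c pos s by (intro nn_integral_normal_density_exp_square) auto
    also have "c * sqrt d / s = 1 + k\<^sup>2 * \<tau>\<^sup>2 / s\<^sup>2"
    proof -
      have "c * sqrt d / s = w\<^sup>2 / s\<^sup>2" using d by (simp add: c_def power2_eq_square)
      then show ?thesis using s by (simp add: w2 add_divide_distrib)
    qed
    finally show ?thesis .
  qed
  have ln_g: "ln (?g (\<theta> \<omega>, Y \<omega>)) = ln (w / s) - t\<^sup>2 / (2 * s\<^sup>2) * (\<epsilon> \<omega>)\<^sup>2 + 1 / (2 * w\<^sup>2) * (Y \<omega>)\<^sup>2" for \<omega>
  proof -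
    have "ln (?g (\<theta> \<omega>, Y \<omega>)) = ln (normal_density (k * \<theta> \<omega>) s (Y \<omega>)) - ln (normal_density 0 w (Y \<omega>))"
      using normal_density_pos[OF s, of "k * \<theta> \<omega>" "Y \<omega>"] normal_density_pos[OF w, of 0 "Y \<omega>"]
      by (simp add: gaussian_likelihood_ratio_def ln_div)
    moreover have "(Y \<omega> - k * \<theta> \<omega>)\<^sup>2 = t\<^sup>2 * (\<epsilon> \<omega>)\<^sup>2" by (simp add: Y_def power_mult_distrib)
    ultimately show ?thesis using s w by (simp add: ln_normal_density ln_div)
  qed
  note E = normal_second_moment[OF pos(4) \<epsilon>] and EY = normal_second_moment[OF w Y]
  show "integrable M (\<lambda>\<omega>. ln (?g (\<theta> \<omega>, Y \<omega>)))"
    unfolding ln_g using E EY by auto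
  have "expectation (\<lambda>\<omega>. ln (?g (\<theta> \<omega>, Y \<omega>))) = ln (w / s) - t\<^sup>2 / (2 * s\<^sup>2) * \<sigma>\<^sup>2 + 1 / (2 * w\<^sup>2) * w\<^sup>2"
    unfolding ln_g using E EY by (simp add: prob_space)
  \<comment> \<open>Both quadratic terms have mean one half, since
    \<open>s = t * \<sigma>\<close>.\<close>
  also have "\<dots> = ln (w / s)"
    using pos w by (simp add: s_def power_mult_distrib)
  also have "\<dots> = ln ((w / s)\<^sup>2) / 2" using w s by (simp add: ln_realpow)
  also have "(w / s)\<^sup>2 = 1 + k\<^sup>2 * \<tau>\<^sup>2 / s\<^sup>2" using s by (simp add: power_divide w2 add_divide_distrib)
  finally show "expectation (\<lambda>\<omega>. ln (?g (\<theta> \<omega>, Y \<omega>))) = ln (1 + k\<^sup>2 * \<tau>\<^sup>2 / s\<^sup>2) / 2" .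
qed

section \<open>Mutual information of sequences with independent pairs\<close>

declare One_nat_def [simp del] \<comment> \<open>keeps the index set in the form \<open>{1..}\<close>\<close>

text \<open>The passage from single pairs to whole sequences, free of Gaussian assumptions. The
  distribution of a pair enters only through its density ratio \<open>g j\<close> and, in the final
  bounds, two moments of that ratio.\<close>

locale indep_pair_sequence = prob_space M
  for M :: "'w measure" +
  fixes X Y :: "nat \<Rightarrow> 'w \<Rightarrow> real" and g :: "nat \<Rightarrow> real \<times> real \<Rightarrow> real"
  assumes indep: "indep_vars (\<lambda>_. borel \<Otimes>\<^sub>M borel) (\<lambda>j \<omega>. (X j \<omega>, Y j \<omega>)) {1..}"
    and g_measurable: "\<And>j. j \<ge> 1 \<Longrightarrow> g j \<in> borel_measurable (borel \<Otimes>\<^sub>M borel)"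
    and g_pos: "\<And>j z. j \<ge> 1 \<Longrightarrow> 0 < g j z"
    and law: "\<And>j. j \<ge> 1 \<Longrightarrow> distr M (borel \<Otimes>\<^sub>M borel) (\<lambda>\<omega>. (X j \<omega>, Y j \<omega>)) =
      density (distr M borel (X j) \<Otimes>\<^sub>M distr M borel (Y j)) (\<lambda>z. ennreal (g j z))"
begin

lemma rv [measurable]:
  assumes "j \<ge> 1"
  shows "random_variable borel (X j)" "random_variable borel (Y j)"
proof -
  have "random_variable (borel \<Otimes>\<^sub>M borel) (\<lambda>\<omega>. (X j \<omega>, Y j \<omega>))"
    using indep assms by (auto simp: indep_vars_def)
  then have [measurable]: "random_variable (borel \<Otimes>\<^sub>M borel) (\<lambda>\<omega>. (X j \<omega>, Y j \<omega>))" .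
  have "random_variable borel (\<lambda>\<omega>. fst (X j \<omega>, Y j \<omega>))" "random_variable borel (\<lambda>\<omega>. snd (X j \<omega>, Y j \<omega>))"
    by measurable
  then show "random_variable borel (X j)" "random_variable borel (Y j)" by simp_all
qed

lemma seq_rv [measurable]:
  "random_variable seq_space (seq_variable X)" "random_variable seq_space (seq_variable Y)"
  unfolding seq_variable_def by (auto intro!: measurable_restrict rv)

lemma coord_measurable:
  assumes "j \<ge> 1"
  shows "(\<lambda>z. (fst z j, snd z j)) \<in> measurable (seq_space \<Otimes>\<^sub>M seq_space) (borel \<Otimes>\<^sub>M borel)"
  using assms by simp

section \<open>The joint law, the product law and the partial products\<close>

definition product_law :: "((nat \<Rightarrow> real) \<times> (nat \<Rightarrow> real)) measure" where
  "product_law = distr M seq_space (seq_variable X) \<Otimes>\<^sub>M distr M seq_space (seq_variable Y)"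

definition joint_law :: "((nat \<Rightarrow> real) \<times> (nat \<Rightarrow> real)) measure" where
  "joint_law = distr M (seq_space \<Otimes>\<^sub>M seq_space) (\<lambda>\<omega>. (seq_variable X \<omega>, seq_variable Y \<omega>))"

definition partial_density :: "nat \<Rightarrow> (nat \<Rightarrow> real) \<times> (nat \<Rightarrow> real) \<Rightarrow> real" where
  "partial_density N z = (\<Prod>j=1..N. g j (fst z j, snd z j))"

lemma sets_product_law [measurable_cong]: "sets product_law = sets (seq_space \<Otimes>\<^sub>M seq_space)"
  unfolding product_law_def by (intro sets_pair_measure_cong) auto

lemma sets_joint_law [measurable_cong]: "sets joint_law = sets (seq_space \<Otimes>\<^sub>M seq_space)"
  unfolding joint_law_def by auto

lemma prob_space_product_law: "prob_space product_law"
proof -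
  interpret PX: prob_space "distr M seq_space (seq_variable X)" by (rule prob_space_distr) simp
  interpret PY: prob_space "distr M seq_space (seq_variable Y)" by (rule prob_space_distr) simp
  interpret pair_prob_space "distr M seq_space (seq_variable X)" "distr M seq_space (seq_variable Y)" ..
  show ?thesis unfolding product_law_def by unfold_locales
qed

lemma prob_space_joint_law: "prob_space joint_law"
  unfolding joint_law_def by (rule prob_space_distr) simp

lemma partial_density_measurable [measurable]:
  "partial_density N \<in> borel_measurable (seq_space \<Otimes>\<^sub>M seq_space)"
  unfolding partial_density_def
  by (intro borel_measurable_prod measurable_compose[OF coord_measurable g_measurable]) auto

lemma partial_density_pos: "0 < partial_density N z"
  unfolding partial_density_def by (auto intro!: prod_pos g_pos)

lemma seq_variable_apply: "j \<ge> 1 \<Longrightarrow> seq_variable Z \<omega> j = Z j \<omega>"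
  by (simp add: seq_variable_def)

text \<open>Under the product law the coordinate pairs are again independent, each with the product
  of its own marginals. By Fubini the second sequence is integrated out first with the first one
  frozen, where independence of the \<open>Y j\<close> factorizes the inner integral into the
  functions \<open>H j\<close>; independence of the \<open>X j\<close> then factorizes the outer
  one.\<close>

lemma nn_integral_product_law:
  fixes k :: "nat \<Rightarrow> real \<times> real \<Rightarrow> ennreal"
  assumes k: "\<And>j. j \<ge> 1 \<Longrightarrow> k j \<in> borel_measurable (borel \<Otimes>\<^sub>M borel)"
  shows "(\<integral>\<^sup>+z. (\<Prod>j=1..N. k j (fst z j, snd z j)) \<partial>product_law) =
    (\<Prod>j=1..N. \<integral>\<^sup>+z. k j z \<partial>(distr M borel (X j) \<Otimes>\<^sub>M distr M borel (Y j)))"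
proof -
  let ?A = "distr M seq_space (seq_variable X)" and ?B = "distr M seq_space (seq_variable Y)"
  interpret PY: prob_space ?B by (rule prob_space_distr) simp
  define H where "H j x = (\<integral>\<^sup>+\<omega>. k j (x, Y j \<omega>) \<partial>M)" for j x
  have Hm: "H j \<in> borel_measurable borel" if "j \<ge> 1" for j
  proof -
    note k[OF that, measurable] rv[OF that, measurable]
    show ?thesis unfolding H_def by measurable
  qed
  have m: "(\<lambda>z. \<Prod>j=1..N. k j (fst z j, snd z j)) \<in> borel_measurable (seq_space \<Otimes>\<^sub>M seq_space)"
    by (intro borel_measurable_prod_ennreal measurable_compose[OF coord_measurable k]) auto
  have m': "(\<lambda>y. \<Prod>j=1..N. k j (x j, y j)) \<in> borel_measurable seq_space"
    if "x \<in> space seq_space" for x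
    using measurable_compose[OF measurable_Pair1'[OF that] m] by simp
  have "(\<integral>\<^sup>+z. (\<Prod>j=1..N. k j (fst z j, snd z j)) \<partial>product_law)
      = (\<integral>\<^sup>+x. \<integral>\<^sup>+y. (\<Prod>j=1..N. k j (x j, y j)) \<partial>?B \<partial>?A)"
  proof -
    have "(\<lambda>z. \<Prod>j=1..N. k j (fst z j, snd z j)) \<in> borel_measurable (?A \<Otimes>\<^sub>M ?B)"
      using m by (simp cong: measurable_cong_sets sets_pair_measure_cong)
    from PY.nn_integral_fst[OF this] show ?thesis by (simp add: product_law_def)
  qed
  also have "\<dots> = (\<integral>\<^sup>+\<omega>. \<integral>\<^sup>+y. (\<Prod>j=1..N. k j (seq_variable X \<omega> j, y j)) \<partial>?B \<partial>M)"
  proof (rule nn_integral_distr)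
    have "(\<lambda>(x, y). \<Prod>j=1..N. k j (x j, y j)) \<in> borel_measurable (seq_space \<Otimes>\<^sub>M ?B)"
      using m by (simp add: case_prod_beta cong: measurable_cong_sets sets_pair_measure_cong)
    then show "(\<lambda>x. \<integral>\<^sup>+y. (\<Prod>j=1..N. k j (x j, y j)) \<partial>?B) \<in>
        borel_measurable (distr M seq_space (seq_variable X))"
      by (simp add: PY.borel_measurable_nn_integral)
  qed simp
  also have "\<dots> = (\<integral>\<^sup>+\<omega>. (\<Prod>j=1..N. H j (X j \<omega>)) \<partial>M)"
  proof (rule nn_integral_cong)
    fix \<omega> assume "\<omega> \<in> space M"
    then have "seq_variable X \<omega> \<in> space seq_space"
      by (rule measurable_space[OF seq_rv(1)])
    then have "(\<integral>\<^sup>+y. (\<Prod>j=1..N. k j (seq_variable X \<omega> j, y j)) \<partial>?B)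
        = (\<integral>\<^sup>+\<omega>'. (\<Prod>j=1..N. k j (seq_variable X \<omega> j, seq_variable Y \<omega>' j)) \<partial>M)"
      using m' by (subst nn_integral_distr) simp_all
    also have "\<dots> = (\<integral>\<^sup>+\<omega>'. (\<Prod>j=1..N. k j (X j \<omega>, Y j \<omega>')) \<partial>M)"
      by (simp add: seq_variable_apply)
    also have "\<dots> = (\<Prod>j=1..N. \<integral>\<^sup>+\<omega>'. k j (X j \<omega>, Y j \<omega>') \<partial>M)"
    proof (rule indep_vars_nn_integral)
      have "indep_vars (\<lambda>_. borel) (\<lambda>j \<omega>'. k j (X j \<omega>, snd (X j \<omega>', Y j \<omega>'))) {1..}"
        by (rule indep_vars_compose2[OF indep, where Y="\<lambda>j z. k j (X j \<omega>, snd z)"])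
          (auto intro!: measurable_compose[OF _ k])
      then show "indep_vars (\<lambda>_. borel) (\<lambda>j \<omega>'. k j (X j \<omega>, Y j \<omega>')) {1..N}"
        by (auto intro: indep_vars_subset)
    qed auto
    finally show "(\<integral>\<^sup>+y. (\<Prod>j=1..N. k j (seq_variable X \<omega> j, y j)) \<partial>?B) = (\<Prod>j=1..N. H j (X j \<omega>))"
      by (simp add: H_def)
  qed
  also have "\<dots> = (\<Prod>j=1..N. \<integral>\<^sup>+\<omega>. H j (X j \<omega>) \<partial>M)"
  proof (rule indep_vars_nn_integral)
    have "indep_vars (\<lambda>_. borel) (\<lambda>j \<omega>. H j (fst (X j \<omega>, Y j \<omega>))) {1..}"
      by (rule indep_vars_compose2[OF indep, where Y="\<lambda>j z. H j (fst z)"])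
        (auto intro!: measurable_compose[OF _ Hm])
    then show "indep_vars (\<lambda>_. borel) (\<lambda>j \<omega>. H j (X j \<omega>)) {1..N}"
      by (auto intro: indep_vars_subset)
  qed auto
  also have "\<dots> = (\<Prod>j=1..N. \<integral>\<^sup>+z. k j z \<partial>(distr M borel (X j) \<Otimes>\<^sub>M distr M borel (Y j)))"
  proof (rule prod.cong[OF refl])
    fix j assume "j \<in> {1..N}"
    then have j: "j \<ge> 1" by simp
    note [measurable] = k[OF j] rv[OF j] Hm[OF j]
    interpret Yj: prob_space "distr M borel (Y j)" by (rule prob_space_distr) simp
    have "(\<integral>\<^sup>+z. k j z \<partial>(distr M borel (X j) \<Otimes>\<^sub>M distr M borel (Y j)))
        = (\<integral>\<^sup>+x. \<integral>\<^sup>+y. k j (x, y) \<partial>distr M borel (Y j) \<partial>distr M borel (X j))"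
      by (rule Yj.nn_integral_fst[symmetric]) simp
    also have "\<dots> = (\<integral>\<^sup>+x. H j x \<partial>distr M borel (X j))"
      by (simp add: H_def nn_integral_distr)
    also have "\<dots> = (\<integral>\<^sup>+\<omega>. H j (X j \<omega>) \<partial>M)"
      by (simp add: nn_integral_distr)
    finally show "(\<integral>\<^sup>+\<omega>. H j (X j \<omega>) \<partial>M) =
      (\<integral>\<^sup>+z. k j z \<partial>(distr M borel (X j) \<Otimes>\<^sub>M distr M borel (Y j)))" ..
  qed
  finally show ?thesis .
qed

section \<open>Change of measure on finitely many coordinates\<close>

lemma nn_integral_prod_pairs:
  fixes h :: "nat \<Rightarrow> real \<times> real \<Rightarrow> ennreal"
  assumes h: "\<And>j. j \<ge> 1 \<Longrightarrow> h j \<in> borel_measurable (borel \<Otimes>\<^sub>M borel)"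
  shows "(\<integral>\<^sup>+\<omega>. (\<Prod>j=1..N. h j (X j \<omega>, Y j \<omega>)) \<partial>M) =
    (\<Prod>j=1..N. \<integral>\<^sup>+\<omega>. h j (X j \<omega>, Y j \<omega>) \<partial>M)"
proof (rule indep_vars_nn_integral)
  have "indep_vars (\<lambda>_. borel) (\<lambda>j \<omega>. h j (X j \<omega>, Y j \<omega>)) {1..}"
    by (rule indep_vars_compose2[OF indep, where Y=h]) (auto intro: h)
  then show "indep_vars (\<lambda>_. borel) (\<lambda>j \<omega>. h j (X j \<omega>, Y j \<omega>)) {1..N}"
    by (auto intro: indep_vars_subset)
qed auto

text \<open>On the first \<open>N\<close> pairs the joint law has density
  \<open>partial_density N\<close> with respect to the product law. Both sides factorize over the
  coordinates, and the factors agree by \<open>law\<close>.\<close>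

lemma nn_integral_partial_density:
  fixes h :: "nat \<Rightarrow> real \<times> real \<Rightarrow> ennreal"
  assumes h: "\<And>j. j \<ge> 1 \<Longrightarrow> h j \<in> borel_measurable (borel \<Otimes>\<^sub>M borel)"
  shows "(\<integral>\<^sup>+\<omega>. (\<Prod>j=1..N. h j (X j \<omega>, Y j \<omega>)) \<partial>M) =
    (\<integral>\<^sup>+z. (\<Prod>j=1..N. h j (fst z j, snd z j)) * ennreal (partial_density N z) \<partial>product_law)"
proof -
  have "(\<integral>\<^sup>+\<omega>. (\<Prod>j=1..N. h j (X j \<omega>, Y j \<omega>)) \<partial>M) = (\<Prod>j=1..N. \<integral>\<^sup>+\<omega>. h j (X j \<omega>, Y j \<omega>) \<partial>M)"
    by (rule nn_integral_prod_pairs[OF h])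
  also have "\<dots> = (\<Prod>j=1..N. \<integral>\<^sup>+z. h j z * ennreal (g j z) \<partial>(distr M borel (X j) \<Otimes>\<^sub>M distr M borel (Y j)))"
  proof (rule prod.cong[OF refl])
    fix j assume "j \<in> {1..N}"
    then have j: "j \<ge> 1" by simp
    note [measurable] = h[OF j] rv[OF j] g_measurable[OF j]
    have "(\<integral>\<^sup>+\<omega>. h j (X j \<omega>, Y j \<omega>) \<partial>M) = (\<integral>\<^sup>+z. h j z \<partial>distr M (borel \<Otimes>\<^sub>M borel) (\<lambda>\<omega>. (X j \<omega>, Y j \<omega>)))"
      by (simp add: nn_integral_distr)
    also have "\<dots> = (\<integral>\<^sup>+z. ennreal (g j z) * h j z \<partial>(distr M borel (X j) \<Otimes>\<^sub>M distr M borel (Y j)))"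
      unfolding law[OF j] by (rule nn_integral_density) simp_all
    finally show "(\<integral>\<^sup>+\<omega>. h j (X j \<omega>, Y j \<omega>) \<partial>M) =
        (\<integral>\<^sup>+z. h j z * ennreal (g j z) \<partial>(distr M borel (X j) \<Otimes>\<^sub>M distr M borel (Y j)))"
      by (simp add: mult.commute)
  qed
  also have "\<dots> = (\<integral>\<^sup>+z. (\<Prod>j=1..N. h j (fst z j, snd z j) * ennreal (g j (fst z j, snd z j))) \<partial>product_law)"
    using h g_measurable by (subst nn_integral_product_law) auto
  also have "\<dots> = (\<integral>\<^sup>+z. (\<Prod>j=1..N. h j (fst z j, snd z j)) * ennreal (partial_density N z) \<partial>product_law)"
    unfolding partial_density_def prod.distrib
    by (subst prod_ennreal) (auto intro: less_imp_le g_pos)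
  finally show ?thesis .
qed

text \<open>A cylinder constrains finitely many coordinates. Once \<open>N\<close> exceeds them all,
  its indicator is a product over \<open>{1..N}\<close> and the finite change of measure applies, so
  the integrals are not merely convergent but eventually constant.\<close>

lemma joint_law_cylinder:
  assumes A: "A \<in> prod_algebra {1..} (\<lambda>_. borel)" and B: "B \<in> prod_algebra {1..} (\<lambda>_. borel)"
  shows "\<exists>N0. \<forall>N\<ge>N0. emeasure joint_law (A \<times> B) =
    (\<integral>\<^sup>+z. ennreal (partial_density N z) * indicator (A \<times> B) z \<partial>product_law)"
proof -
  obtain J1 E1 where A': "A = prod_emb {1..} (\<lambda>_. borel) J1 (\<Pi>\<^sub>E j\<in>J1. E1 j)" "finite J1" "J1 \<subseteq> {1..}"
      "\<And>i. i \<in> J1 \<Longrightarrow> E1 i \<in> sets borel"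
    by (rule prod_algebraE[OF A]) auto
  obtain J2 E2 where B': "B = prod_emb {1..} (\<lambda>_. borel) J2 (\<Pi>\<^sub>E j\<in>J2. E2 j)" "finite J2" "J2 \<subseteq> {1..}"
      "\<And>i. i \<in> J2 \<Longrightarrow> E2 i \<in> sets borel"
    by (rule prod_algebraE[OF B]) auto
  have meas: "A \<in> sets seq_space" "B \<in> sets seq_space"
    using A B by (auto simp: sets_PiM intro: sigma_sets.Basic)
  define U where "U j = (if j \<in> J1 then E1 j else UNIV) \<times> (if j \<in> J2 then E2 j else UNIV)" for j
  have Um: "U j \<in> sets (borel \<Otimes>\<^sub>M borel)" for j
    using A' B' by (auto simp: U_def)
  obtain N0 where N0: "J1 \<union> J2 \<subseteq> {..N0}"
    using finite_nat_iff_bounded_le[of "J1 \<union> J2"] A'(2) B'(2) by auto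
  have "emeasure joint_law (A \<times> B) =
    (\<integral>\<^sup>+z. ennreal (partial_density N z) * indicator (A \<times> B) z \<partial>product_law)" if "N \<ge> N0" for N
  proof -
    have J: "J1 \<subseteq> {1..N}" "J2 \<subseteq> {1..N}"
      using N0 \<open>N \<ge> N0\<close> A'(3) B'(3) by fastforce+
    \<comment> \<open>The restriction to the space matters: \<open>prod_emb\<close> contains only
      functions that are undefined off the index set.\<close>
    have ind: "indicator (A \<times> B) z = (\<Prod>j=1..N. indicator (U j) (fst z j, snd z j) :: ennreal)"
      if z: "z \<in> space (seq_space \<Otimes>\<^sub>M seq_space)" for z
    proof -
      have "z \<in> A \<times> B \<longleftrightarrow> (\<forall>j\<in>{1..N}. (fst z j, snd z j) \<in> U j)"
        using z J
        by (auto simp: A'(1) B'(1) U_def prod_emb_def space_pair_measure space_PiM PiE_iff subset_eq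
            mem_Times_iff Ball_def split: if_splits)
      moreover have "(\<Prod>j\<in>{1..N}. indicator (U j) (fst z j, snd z j) :: ennreal) =
          (if \<forall>j\<in>{1..N}. (fst z j, snd z j) \<in> U j then 1 else 0)"
        by (auto simp: indicator_def intro!: prod.neutral)
      ultimately show ?thesis by (simp add: indicator_def)
    qed
    have "emeasure joint_law (A \<times> B) = (\<integral>\<^sup>+z. indicator (A \<times> B) z \<partial>joint_law)"
      using meas by (simp add: sets_joint_law)
    also have "\<dots> = (\<integral>\<^sup>+\<omega>. indicator (A \<times> B) (seq_variable X \<omega>, seq_variable Y \<omega>) \<partial>M)"
      unfolding joint_law_def using meas by (subst nn_integral_distr) auto
    also have "\<dots> = (\<integral>\<^sup>+\<omega>. (\<Prod>j=1..N. indicator (U j) (X j \<omega>, Y j \<omega>)) \<partial>M)"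
    proof (rule nn_integral_cong)
      fix \<omega> assume "\<omega> \<in> space M"
      then have "(seq_variable X \<omega>, seq_variable Y \<omega>) \<in> space (seq_space \<Otimes>\<^sub>M seq_space)"
        using seq_rv[THEN measurable_space] by (auto simp: space_pair_measure)
      from ind[OF this] show "indicator (A \<times> B) (seq_variable X \<omega>, seq_variable Y \<omega>) =
          (\<Prod>j=1..N. indicator (U j) (X j \<omega>, Y j \<omega>) :: ennreal)"
        by (simp add: seq_variable_apply)
    qed
    also have "\<dots> = (\<integral>\<^sup>+z. (\<Prod>j=1..N. indicator (U j) (fst z j, snd z j)) * ennreal (partial_density N z) \<partial>product_law)"
      using Um by (intro nn_integral_partial_density) auto
    also have "\<dots> = (\<integral>\<^sup>+z. ennreal (partial_density N z) * indicator (A \<times> B) z \<partial>product_law)"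
      by (rule nn_integral_cong)
        (simp add: ind sets_eq_imp_space_eq[OF sets_product_law] mult.commute)
    finally show ?thesis .
  qed
  then show ?thesis by blast
qed

text \<open>Uniqueness of measures on an intersection-stable generator, here the rectangles of
  cylinders. The whole space is such a rectangle and has finite joint mass, so a constant sequence
  exhausts it.\<close>

lemma joint_law_eqI:
  assumes N: "sets N = sets (seq_space \<Otimes>\<^sub>M seq_space)"
    and eq: "\<And>A B. A \<in> prod_algebra {1..} (\<lambda>_. borel) \<Longrightarrow> B \<in> prod_algebra {1..} (\<lambda>_. borel) \<Longrightarrow>
      emeasure joint_law (A \<times> B) = emeasure N (A \<times> B)"
  shows "joint_law = N"
proof -
  let ?G = "prod_algebra {1..} (\<lambda>_. borel) :: (nat \<Rightarrow> real) set set"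
  let ?S = "space (seq_space :: (nat \<Rightarrow> real) measure)"
  let ?E = "{a \<times> b | a b. a \<in> ?G \<and> b \<in> ?G}"
  have S: "?S \<in> ?G" unfolding space_PiM by (rule space_in_prod_algebra)
  have sub: "?G \<subseteq> Pow ?S" unfolding space_PiM by (rule prod_algebra_sets_into_space)
  have sets: "sets (seq_space \<Otimes>\<^sub>M seq_space) = sigma_sets (?S \<times> ?S) ?E"
  proof -
    have "sets (seq_space \<Otimes>\<^sub>M seq_space) = sets (sigma (?S \<times> ?S) ?E)"
      by (rule sets_pair_eq[where Ca="{?S}" and Cb="{?S}"])
        (use S sub in \<open>auto simp: sets_PiM space_PiM\<close>)
    also have "\<dots> = sigma_sets (?S \<times> ?S) ?E"
      using sub by (intro sets_measure_of) blast
    finally show ?thesis .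
  qed
  interpret J: prob_space joint_law by (rule prob_space_joint_law)
  show ?thesis
  proof (rule measure_eqI_generator_eq[where E="?E" and \<Omega>="?S \<times> ?S" and A="\<lambda>_. ?S \<times> ?S"])
    show "Int_stable ?E"
    proof (rule Int_stableI)
      fix u v assume "u \<in> ?E" "v \<in> ?E"
      then obtain a b a' b' where ab: "u = a \<times> b" "v = a' \<times> b'" "a \<in> ?G" "b \<in> ?G" "a' \<in> ?G" "b' \<in> ?G"
        by blast
      then have "a \<inter> a' \<in> ?G" "b \<inter> b' \<in> ?G"
        using Int_stableD[OF Int_stable_prod_algebra] by metis+
      then show "u \<inter> v \<in> ?E" unfolding ab Times_Int_Times by blast
    qed
    show "?E \<subseteq> Pow (?S \<times> ?S)" using sub by blast
    show "range (\<lambda>_::nat. ?S \<times> ?S) \<subseteq> ?E" using S by blast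
  qed (use eq N sets in \<open>auto simp: sets_joint_law\<close>)
qed

text \<open>This is the orthogonality hypothesis of \<open>L2_martingale_limit\<close>. The factor
  \<open>partial_density n\<close> changes the measure to the joint law, under which the remaining
  product up to \<open>m\<close> has independent factors of mean \<open>c j\<close>.\<close>

lemma nn_integral_partial_density_mult:
  assumes c: "\<And>j. j \<ge> 1 \<Longrightarrow> (\<integral>\<^sup>+\<omega>. ennreal (g j (X j \<omega>, Y j \<omega>)) \<partial>M) = ennreal (c j)"
    and c0: "\<And>j. j \<ge> 1 \<Longrightarrow> 0 \<le> c j" and "m \<le> n"
  shows "(\<integral>\<^sup>+z. ennreal (partial_density m z * partial_density n z) \<partial>product_law)
    = ennreal (\<Prod>j=1..m. c j)"
proof -
  \<comment> \<open>The product up to \<open>m\<close> is padded with ones to length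
    \<open>n\<close>; these contribute total mass 1.\<close>
  define h where "h j z = (if j \<le> m then ennreal (g j z) else 1)" for j z
  have split: "{1..n} = {1..m} \<union> {m<..n}" "{1..m} \<inter> {m<..n} = {}" using \<open>m \<le> n\<close> by auto
  have hm: "h j \<in> borel_measurable (borel \<Otimes>\<^sub>M borel)" if "j \<ge> 1" for j
    using g_measurable[OF that] by (cases "j \<le> m") (simp_all add: h_def[abs_def])
  have "(\<integral>\<^sup>+z. ennreal (partial_density m z * partial_density n z) \<partial>product_law)
      = (\<integral>\<^sup>+z. (\<Prod>j=1..n. h j (fst z j, snd z j)) * ennreal (partial_density n z) \<partial>product_law)"
  proof (rule nn_integral_cong)
    fix z
    have "(\<Prod>j=1..n. h j (fst z j, snd z j)) = (\<Prod>j=1..m. ennreal (g j (fst z j, snd z j)))"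
      unfolding split(1) using split(2) by (subst prod.union_disjoint) (auto simp: h_def)
    also have "\<dots> = ennreal (partial_density m z)"
      unfolding partial_density_def by (subst prod_ennreal) (auto intro: less_imp_le g_pos)
    finally show "ennreal (partial_density m z * partial_density n z) =
        (\<Prod>j=1..n. h j (fst z j, snd z j)) * ennreal (partial_density n z)"
      using partial_density_pos by (simp add: ennreal_mult less_imp_le)
  qed
  also have "\<dots> = (\<Prod>j=1..n. \<integral>\<^sup>+\<omega>. h j (X j \<omega>, Y j \<omega>) \<partial>M)"
    using nn_integral_partial_density[of h n] nn_integral_prod_pairs[of h n] hm by simp
  also have "\<dots> = (\<Prod>j=1..m. ennreal (c j))"
    unfolding split(1) using split(2)
    by (subst prod.union_disjoint) (auto simp: h_def c emeasure_space_1)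
  also have "\<dots> = ennreal (\<Prod>j=1..m. c j)"
    using c0 by (intro prod_ennreal) auto
  finally show ?thesis .
qed

text \<open>The limit \<open>f\<close> of the partial products is a density of the joint law, since
  both measures agree on cylinders. Its second moment is at most \<open>C\<close>, which yields the
  upper bound. Testing the divergence with \<open>partial_density N\<close> yields the lower bound,
  because the expected logarithm of the product is the sum of the coordinate expectations.\<close>

theorem mutual_information_bounds:
  assumes c: "\<And>j. j \<ge> 1 \<Longrightarrow> (\<integral>\<^sup>+\<omega>. ennreal (g j (X j \<omega>, Y j \<omega>)) \<partial>M) = ennreal (c j)"
    and c0: "\<And>j. j \<ge> 1 \<Longrightarrow> 0 \<le> c j" and C: "\<And>N. (\<Prod>j=1..N. c j) \<le> C"
    and int: "\<And>j. j \<ge> 1 \<Longrightarrow> integrable M (\<lambda>\<omega>. ln (g j (X j \<omega>, Y j \<omega>)))"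
  defines "I \<equiv> mutual_information (exp 1) seq_space seq_space (seq_variable X) (seq_variable Y)"
  shows "I \<le> ln C" and "(\<Sum>j=1..N. expectation (\<lambda>\<omega>. ln (g j (X j \<omega>, Y j \<omega>)))) \<le> I"
proof -
  interpret Q: prob_space product_law by (rule prob_space_product_law)
  interpret J: prob_space joint_law by (rule prob_space_joint_law)
  \<comment> \<open>The empty product gives \<open>1 \<le> C\<close>.\<close>
  have "C > 0" using C[of 0] by simp
  have pm: "partial_density N \<in> borel_measurable product_law" for N by measurable
  obtain f r where f: "f \<in> borel_measurable product_law" "\<And>x. 0 \<le> f x" "strict_mono r"
    "(\<integral>\<^sup>+x. ennreal ((f x)\<^sup>2) \<partial>product_law) \<le> ennreal C"
    "\<And>A. A \<in> sets product_law \<Longrightarrow>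
        (\<lambda>i. \<integral>\<^sup>+x. ennreal (partial_density (r i) x) * indicator A x \<partial>product_law)
        \<longlonglongrightarrow> (\<integral>\<^sup>+x. ennreal (f x) * indicator A x \<partial>product_law)"
    by (rule Q.L2_martingale_limit[of partial_density "\<lambda>n. \<Prod>j=1..n. c j" C])
      (use pm C c0 nn_integral_partial_density_mult[OF c c0] in
        \<open>auto intro: less_imp_le partial_density_pos prod_nonneg\<close>)
  note f(1)[measurable]
  have eq: "joint_law = density product_law f"
  proof (rule joint_law_eqI)
    show "sets (density product_law f) = sets (seq_space \<Otimes>\<^sub>M seq_space)"
      by (simp add: sets_product_law)
    fix A B :: "(nat \<Rightarrow> real) set"
    assume AB: "A \<in> prod_algebra {1..} (\<lambda>_. borel)" "B \<in> prod_algebra {1..} (\<lambda>_. borel)"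
    then have "A \<in> sets seq_space" "B \<in> sets seq_space"
      by (auto simp: sets_PiM intro: sigma_sets.Basic)
    then have AB': "A \<times> B \<in> sets product_law" by (simp add: sets_product_law)
    obtain N0 where N0: "\<And>N. N \<ge> N0 \<Longrightarrow> emeasure joint_law (A \<times> B) =
        (\<integral>\<^sup>+z. ennreal (partial_density N z) * indicator (A \<times> B) z \<partial>product_law)"
      using joint_law_cylinder[OF AB] by blast
    \<comment> \<open>The same integrals converge to the mass under \<open>f\<close> by the
      martingale limit and are eventually equal to the joint mass, so the two coincide.\<close>
    have "(\<lambda>i. \<integral>\<^sup>+x. ennreal (partial_density (r i) x) * indicator (A \<times> B) x \<partial>product_law)
        \<longlonglongrightarrow> emeasure joint_law (A \<times> B)"
    proof (rule tendsto_eventually, rule eventually_sequentiallyI[of N0])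
      fix i assume "i \<ge> N0"
      then have "r i \<ge> N0" using seq_suble[OF f(3)] le_trans by blast
      from N0[OF this] show "(\<integral>\<^sup>+x. ennreal (partial_density (r i) x) * indicator (A \<times> B) x \<partial>product_law) =
        emeasure joint_law (A \<times> B)" ..
    qed
    with f(5)[OF AB'] have "emeasure joint_law (A \<times> B) =
        (\<integral>\<^sup>+x. ennreal (f x) * indicator (A \<times> B) x \<partial>product_law)"
      by (rule LIMSEQ_unique[rotated])
    then show "emeasure joint_law (A \<times> B) = emeasure (density product_law f) (A \<times> B)"
      using AB' by (simp add: emeasure_density)
  qed
  note fi = Q.integrable_of_square_bound(2)[OF f(1) f(4)]
  have int1: "(\<integral>x. f x \<partial>product_law) = 1"
  proof -
    have "ennreal (\<integral>x. f x \<partial>product_law) = (\<integral>\<^sup>+x. ennreal (f x) \<partial>product_law)"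
      using fi f(2) by (subst nn_integral_eq_integral) auto
    also have "\<dots> = emeasure (density product_law f) (space product_law)"
      by (subst emeasure_density) (auto intro!: nn_integral_cong)
    also have "\<dots> = ennreal 1"
      using J.emeasure_space_1 sets_eq_imp_space_eq[OF trans[OF sets_joint_law sets_product_law[symmetric]]]
      by (simp add: eq[symmetric])
    finally show ?thesis
      using ennreal_inj[of "\<integral>x. f x \<partial>product_law" 1] f(2) by simp
  qed
  have I: "I = KL_divergence (exp 1) product_law (density product_law f)"
    unfolding I_def mutual_information_def product_law_def[symmetric] joint_law_def[symmetric] eq ..
  note up = Q.KL_density_le_ln[OF f(1) f(2) f(4) int1 \<open>C > 0\<close>]
  show "I \<le> ln C" unfolding I by (rule up(2))
  have ln_pd: "ln (partial_density N z) = (\<Sum>j=1..N. ln (g j (fst z j, snd z j)))" for z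
    unfolding partial_density_def by (rule ln_prod, simp) (metis atLeastAtMost_iff g_pos less_irrefl)
  have gm: "(\<lambda>z. ln (g j (fst z j, snd z j))) \<in> borel_measurable (seq_space \<Otimes>\<^sub>M seq_space)" if "j \<ge> 1" for j
    using measurable_compose[OF coord_measurable g_measurable] that by measurable
  have intJ: "integrable joint_law (\<lambda>z. ln (g j (fst z j, snd z j)))"
      "(\<integral>z. ln (g j (fst z j, snd z j)) \<partial>joint_law) = expectation (\<lambda>\<omega>. ln (g j (X j \<omega>, Y j \<omega>)))"
    if "j \<ge> 1" for j
    unfolding joint_law_def using int[OF that] gm[OF that] that
    by (auto simp: integrable_distr_eq integral_distr seq_variable_apply)
  have one: "(\<integral>\<^sup>+z. ennreal (partial_density N z) \<partial>product_law) = 1"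
    using nn_integral_partial_density[of "\<lambda>_ _. 1" N] by (simp add: emeasure_space_1)
  have pint: "integrable product_law (partial_density N)"
    using one pm by (intro integrableI_nonneg) (auto intro: less_imp_le partial_density_pos)
  have pone: "(\<integral>z. partial_density N z \<partial>product_law) \<le> 1"
    using one pm by (subst integral_eq_nn_integral) (auto intro: less_imp_le partial_density_pos)
  have "(\<Sum>j=1..N. expectation (\<lambda>\<omega>. ln (g j (X j \<omega>, Y j \<omega>)))) = (\<integral>z. ln (partial_density N z) \<partial>joint_law)"
    unfolding ln_pd using intJ by (subst Bochner_Integration.integral_sum) auto
  also have "\<dots> \<le> I"
    unfolding I eq
    using intJ by (intro Q.KL_density_ge f up(1) fi int1 partial_density_pos pint pone)
      (auto simp: ln_pd eq[symmetric])
  finally show "(\<Sum>j=1..N. expectation (\<lambda>\<omega>. ln (g j (X j \<omega>, Y j \<omega>)))) \<le> I" .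
qed

end

declare One_nat_def [simp]

section \<open>The Gaussian sequence experiment\<close>

text \<open>Blocks of an independent family are independent. The blocks
  \<open>{Inl j, Inr j}\<close> give independence between pairs, the singletons
  \<open>{Inl j}\<close> and \<open>{Inr j}\<close> independence within one.\<close>

lemma (in prob_space)
  fixes X Y :: "nat \<Rightarrow> 'a \<Rightarrow> real"
  assumes "indep_vars (\<lambda>_. borel) (case_sum X Y) (I <+> I)"
  shows indep_vars_case_sum_pairs: "indep_vars (\<lambda>_. borel \<Otimes>\<^sub>M borel) (\<lambda>j \<omega>. (X j \<omega>, Y j \<omega>)) I"
    and indep_vars_case_sum_indep_var: "j \<in> I \<Longrightarrow> indep_var borel (X j) borel (Y j)"
proof -
  let ?K = "\<lambda>j. {Inl j, Inr j} :: (nat + nat) set"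
  have "indep_vars (\<lambda>j. PiM (?K j) (\<lambda>_. borel)) (\<lambda>j \<omega>. restrict (\<lambda>i. case_sum X Y i \<omega>) (?K j)) I"
    by (rule indep_vars_restrict[OF assms]) (auto simp: disjoint_family_on_def)
  then have "indep_vars (\<lambda>_. borel \<Otimes>\<^sub>M borel)
      (\<lambda>j \<omega>. (\<lambda>w. (w (Inl j), w (Inr j))) (restrict (\<lambda>i. case_sum X Y i \<omega>) (?K j))) I"
    by (rule indep_vars_compose2) simp
  then show "indep_vars (\<lambda>_. borel \<Otimes>\<^sub>M borel) (\<lambda>j \<omega>. (X j \<omega>, Y j \<omega>)) I" by simp
  assume j: "j \<in> I"
  have "indep_var (PiM {Inl j} (\<lambda>_. borel)) (\<lambda>\<omega>. restrict (\<lambda>i. case_sum X Y i \<omega>) {Inl j})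
      (PiM {Inr j} (\<lambda>_. borel)) (\<lambda>\<omega>. restrict (\<lambda>i. case_sum X Y i \<omega>) {Inr j})"
    by (rule indep_var_restrict[OF assms]) (use j in auto)
  then have "indep_var borel ((\<lambda>w. w (Inl j)) \<circ> (\<lambda>\<omega>. restrict (\<lambda>i. case_sum X Y i \<omega>) {Inl j}))
      borel ((\<lambda>w. w (Inr j)) \<circ> (\<lambda>\<omega>. restrict (\<lambda>i. case_sum X Y i \<omega>) {Inr j}))"
    by (rule indep_var_compose) simp_all
  then show "indep_var borel (X j) borel (Y j)" by (simp add: comp_def)
qed

text \<open>The second moments of the coordinate ratios are \<open>1 + n * a j\<close>, so their
  products are at most \<open>exp B\<close> and the information at most \<open>B\<close>. The
  coordinate informations are \<open>ln (1 + n * a j) / 2\<close>, whence the lower bound. The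
  factor 2 between the two does not affect the order of growth.\<close>

lemma info_bounds:
  assumes gauss: "gaussian_sequence_experiment M \<theta> \<epsilon> \<kappa> \<tau> \<sigma>" and n: "n \<ge> 1"
    and B: "\<And>N. (\<Sum>j=1..N. ln (1 + real n * snr \<kappa> \<tau> \<sigma> j)) \<le> B"
  shows "info M \<theta> \<epsilon> \<kappa> n \<le> B"
    and "(\<Sum>j=1..N. ln (1 + real n * snr \<kappa> \<tau> \<sigma> j)) / 2 \<le> info M \<theta> \<epsilon> \<kappa> n"
proof -
  interpret prob_space M using gauss by (simp add: gaussian_sequence_experiment_def)
  have pos: "\<And>j. j \<ge> 1 \<Longrightarrow> 0 < \<kappa> j" "\<And>j. j \<ge> 1 \<Longrightarrow> 0 < \<tau> j" "0 < \<sigma>"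
    and \<theta>: "\<And>j. j \<ge> 1 \<Longrightarrow> distributed M lborel (\<theta> j) (normal_density 0 (\<tau> j))"
    and \<epsilon>: "\<And>j. j \<ge> 1 \<Longrightarrow> distributed M lborel (\<epsilon> j) (normal_density 0 \<sigma>)"
    and ind: "indep_vars (\<lambda>_. borel) (case_sum \<theta> \<epsilon>) ({1..} <+> {1..})"
    using gauss by (auto simp: gaussian_sequence_experiment_def)
  \<comment> \<open>The effective noise deviation is \<open>t * \<sigma>\<close>;
    \<open>t\<^sup>2 = 1 / n\<close> then turns the signal-to-noise ratio of coordinate
    \<open>j\<close> into \<open>n * snr \<kappa> \<tau> \<sigma> j\<close>.\<close>
  define t where "t = real n powr (-1/2)"
  have t: "t > 0" using n by (simp add: t_def)
  have t2: "t\<^sup>2 = 1 / real n"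
    using n by (simp add: t_def powr_minus_divide power_divide powr_half_sqrt)
  let ?Y = "observation \<theta> \<epsilon> \<kappa> n"
  define g where "g j = gaussian_likelihood_ratio (\<kappa> j) (t * \<sigma>) (sqrt ((\<kappa> j)\<^sup>2 * (\<tau> j)\<^sup>2 + (t * \<sigma>)\<^sup>2))" for j
  have Y: "?Y j = (\<lambda>\<omega>. \<kappa> j * \<theta> j \<omega> + t * \<epsilon> j \<omega>)" for j
    by (simp add: observation_def fun_eq_iff t_def)
  have snr: "1 + (\<kappa> j)\<^sup>2 * (\<tau> j)\<^sup>2 / (t * \<sigma>)\<^sup>2 = 1 + real n * snr \<kappa> \<tau> \<sigma> j" for j
    using n by (simp add: snr_def power_mult_distrib t2)
  have iv: "indep_var borel (\<theta> j) borel (\<epsilon> j)" if "j \<ge> 1" for j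
    using indep_vars_case_sum_indep_var[OF ind] that by simp
  interpret indep_pair_sequence M \<theta> ?Y g
  proof
    have "indep_vars (\<lambda>_. borel \<Otimes>\<^sub>M borel) (\<lambda>j \<omega>. (\<lambda>z. (fst z, \<kappa> j * fst z + t * snd z)) (\<theta> j \<omega>, \<epsilon> j \<omega>)) {1..}"
      by (rule indep_vars_compose2[OF indep_vars_case_sum_pairs[OF ind]]) simp
    then show "indep_vars (\<lambda>_. borel \<Otimes>\<^sub>M borel) (\<lambda>j \<omega>. (\<theta> j \<omega>, ?Y j \<omega>)) {1..}"
      by (simp add: Y)
    fix j :: nat assume j: "j \<ge> 1"
    show "g j \<in> borel_measurable (borel \<Otimes>\<^sub>M borel)" unfolding g_def by measurable
    have "0 < (\<kappa> j)\<^sup>2 * (\<tau> j)\<^sup>2 + (t * \<sigma>)\<^sup>2" using pos t by (simp add: add_nonneg_pos)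
    then show "0 < g j z" for z
      using t pos by (simp add: g_def gaussian_likelihood_ratio_pos)
    show "distr M (borel \<Otimes>\<^sub>M borel) (\<lambda>\<omega>. (\<theta> j \<omega>, ?Y j \<omega>)) =
        density (distr M borel (\<theta> j) \<Otimes>\<^sub>M distr M borel (?Y j)) (\<lambda>z. ennreal (g j z))"
      unfolding g_def Y by (rule gaussian_pair_law) (use pos j t \<theta> \<epsilon> iv in auto)
  qed
  define c where "c j = 1 + real n * snr \<kappa> \<tau> \<sigma> j" for j
  have c: "c j > 0" for j by (simp add: c_def snr_def add_pos_nonneg)
  have 1: "(\<integral>\<^sup>+\<omega>. ennreal (g j (\<theta> j \<omega>, ?Y j \<omega>)) \<partial>M) = ennreal (c j)"
    and 2: "integrable M (\<lambda>\<omega>. ln (g j (\<theta> j \<omega>, ?Y j \<omega>)))"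
    and 3: "expectation (\<lambda>\<omega>. ln (g j (\<theta> j \<omega>, ?Y j \<omega>))) = ln (c j) / 2" if j: "j \<ge> 1" for j
    unfolding g_def Y c_def snr[symmetric]
    by (rule nn_expectation_gaussian_likelihood_ratio; use pos j t \<theta> \<epsilon> iv in simp)
      (rule integrable_ln_gaussian_likelihood_ratio expectation_ln_gaussian_likelihood_ratio;
        use pos j t \<theta> \<epsilon> iv in simp)+
  have 4: "(\<Prod>j=1..N. c j) \<le> exp B" for N
  proof -
    have "(\<Prod>j=1..N. c j) = exp (\<Sum>j=1..N. ln (c j))"
      using c by (simp add: exp_sum)
    also have "\<dots> \<le> exp B" using B[of N] by (simp add: c_def)
    finally show ?thesis .
  qed
  note bounds = mutual_information_bounds[OF 1 less_imp_le[OF c] 4 2]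
  show "info M \<theta> \<epsilon> \<kappa> n \<le> B"
    using bounds(1) by (simp add: info_def)
  show "(\<Sum>j=1..N. ln (1 + real n * snr \<kappa> \<tau> \<sigma> j)) / 2 \<le> info M \<theta> \<epsilon> \<kappa> n"
  proof -
    have "(\<Sum>j=1..N. ln (c j)) / 2 = (\<Sum>j=1..N. expectation (\<lambda>\<omega>. ln (g j (\<theta> j \<omega>, ?Y j \<omega>))))"
      unfolding sum_divide_distrib by (rule sum.cong) (simp_all add: 3)
    also have "\<dots> \<le> info M \<theta> \<epsilon> \<kappa> n" using bounds(2) by (simp only: info_def)
    finally show ?thesis by (simp only: c_def)
  qed
qed

lemma comparable_info:
  fixes q c1 c2 :: real
  assumes gauss: "gaussian_sequence_experiment M \<theta> \<epsilon> \<kappa> \<tau> \<sigma>"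
    and q: "q > 1" and c: "0 < c1" "c1 \<le> c2"
    and snr: "\<And>j. j \<ge> 1 \<Longrightarrow> c1 * real j powr (-q) \<le> snr \<kappa> \<tau> \<sigma> j"
      "\<And>j. j \<ge> 1 \<Longrightarrow> snr \<kappa> \<tau> \<sigma> j \<le> c2 * real j powr (-q)"
  shows "comparable_on {1..} (info M \<theta> \<epsilon> \<kappa>) (\<lambda>n. real n powr (1/q))"
    and "comparable_on {3..} (d_eff M \<theta> \<epsilon> \<kappa>) (\<lambda>n. real n powr (1/q) / ln (real n))"
proof -
  let ?S = "\<lambda>n N. \<Sum>j=1..N. ln (1 + real n * snr \<kappa> \<tau> \<sigma> j)"
  obtain K L where KL: "K > 0" "L > 0"
    and KL_bounds: "\<forall>a. (\<forall>j\<ge>1. c1 * real j powr (-q) \<le> a j \<and> a j \<le> c2 * real j powr (-q)) \<longrightarrow>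
      (\<forall>n\<ge>1. (\<forall>N. (\<Sum>j=1..N. ln (1 + real n * a j)) \<le> K * real n powr (1 / q)) \<and>
        (\<exists>N. L * real n powr (1 / q) \<le> (\<Sum>j=1..N. ln (1 + real n * a j))))"
    using sum_ln_one_plus_bounds[OF q c] by auto
  have "(\<forall>N. ?S n N \<le> K * real n powr (1 / q)) \<and> (\<exists>N. L * real n powr (1 / q) \<le> ?S n N)" if "n \<ge> 1" for n
    using KL_bounds[rule_format, of "snr \<kappa> \<tau> \<sigma>" n] snr that by simp
  then have sums: "?S n N \<le> K * real n powr (1 / q)" "\<exists>N. L * real n powr (1 / q) \<le> ?S n N"
    if "n \<ge> 1" for n N using that by blast+
  have bounds: "L / 2 \<le> info M \<theta> \<epsilon> \<kappa> n / real n powr (1/q)" "info M \<theta> \<epsilon> \<kappa> n / real n powr (1/q) \<le> K"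
    if n: "n \<ge> 1" for n
  proof -
    have x: "real n powr (1/q) > 0" using n by simp
    note b = info_bounds[OF gauss n sums(1)[OF n]]
    show "info M \<theta> \<epsilon> \<kappa> n / real n powr (1/q) \<le> K" using b(1) x by (simp add: field_simps)
    obtain N where "L * real n powr (1 / q) \<le> (\<Sum>j=1..N. ln (1 + real n * snr \<kappa> \<tau> \<sigma> j))"
      using sums(2)[OF n] by blast
    with b(2)[of N] have "L / 2 * real n powr (1 / q) \<le> info M \<theta> \<epsilon> \<kappa> n" by simp
    then show "L / 2 \<le> info M \<theta> \<epsilon> \<kappa> n / real n powr (1/q)" using x by (simp add: pos_le_divide_eq)
  qed
  show "comparable_on {1..} (info M \<theta> \<epsilon> \<kappa>) (\<lambda>n. real n powr (1/q))"
    unfolding comparable_on_def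
    by (rule exI[of _ "L / 2"], rule conjI, simp add: KL, rule exI[of _ K]) (use KL bounds in auto)
  \<comment> \<open>For \<open>n \<ge> 3\<close> the logarithm is positive, so it cancels and only
    the factor 2 in \<open>d_eff\<close> remains.\<close>
  have ratio: "d_eff M \<theta> \<epsilon> \<kappa> n / (real n powr (1/q) / ln (real n)) = 2 * (info M \<theta> \<epsilon> \<kappa> n / real n powr (1/q))"
    if "n \<ge> 3" for n
  proof -
    have "ln (real n) > 0" using that by simp
    then show ?thesis by (simp add: d_eff_def)
  qed
  have "L \<le> d_eff M \<theta> \<epsilon> \<kappa> n / (real n powr (1/q) / ln (real n))"
      "d_eff M \<theta> \<epsilon> \<kappa> n / (real n powr (1/q) / ln (real n)) \<le> 2 * K" if "n \<ge> 3" for n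
    unfolding ratio[OF that] using bounds[of n] that by linarith+
  then show "comparable_on {3..} (d_eff M \<theta> \<epsilon> \<kappa>) (\<lambda>n. real n powr (1/q) / ln (real n))"
    unfolding comparable_on_def
    by (intro exI[of _ L] conjI KL exI[of _ "2 * K"] ballI) (use KL in auto)
qed

text \<open>The exponents add, so the normalized signal-to-noise ratio is the product of the two
  normalized sequences divided by \<open>\<sigma>\<^sup>2\<close>, and the bounds multiply.\<close>

lemma snr_power_law:
  fixes a s :: real
  assumes \<kappa>: "comparable_on {1..} (\<lambda>j. (\<kappa> j)\<^sup>2) (\<lambda>j. real j powr (- 2 * a))"
    and \<tau>: "comparable_on {1..} (\<lambda>j. (\<tau> j)\<^sup>2) (\<lambda>j. real j powr (- 1 - 2 * s))"
    and \<sigma>: "\<sigma> > 0"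
  shows "\<exists>c1 c2. 0 < c1 \<and> c1 \<le> c2 \<and>
    (\<forall>j\<ge>1. c1 * real j powr (- (2 * a + 2 * s + 1)) \<le> snr \<kappa> \<tau> \<sigma> j \<and>
      snr \<kappa> \<tau> \<sigma> j \<le> c2 * real j powr (- (2 * a + 2 * s + 1)))"
proof -
  obtain k1 k2 where k: "k1 > 0" "k2 > 0"
    "\<And>j. j \<ge> 1 \<Longrightarrow> k1 \<le> (\<kappa> j)\<^sup>2 / real j powr (- 2 * a) \<and> (\<kappa> j)\<^sup>2 / real j powr (- 2 * a) \<le> k2"
    using \<kappa> unfolding comparable_on_def by (metis atLeast_iff)
  obtain t1 t2 where t: "t1 > 0" "t2 > 0"
    "\<And>j. j \<ge> 1 \<Longrightarrow> t1 \<le> (\<tau> j)\<^sup>2 / real j powr (- 1 - 2 * s) \<and> (\<tau> j)\<^sup>2 / real j powr (- 1 - 2 * s) \<le> t2"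
    using \<tau> unfolding comparable_on_def by (metis atLeast_iff)
  have bd: "k1 * t1 / \<sigma>\<^sup>2 \<le> snr \<kappa> \<tau> \<sigma> j / real j powr (- (2 * a + 2 * s + 1)) \<and>
      snr \<kappa> \<tau> \<sigma> j / real j powr (- (2 * a + 2 * s + 1)) \<le> k2 * t2 / \<sigma>\<^sup>2" if j: "j \<ge> 1" for j
  proof -
    let ?u = "(\<kappa> j)\<^sup>2 / real j powr (- 2 * a)" and ?v = "(\<tau> j)\<^sup>2 / real j powr (- 1 - 2 * s)"
    have "real j powr (- (2 * a + 2 * s + 1)) = real j powr (- 2 * a) * real j powr (- 1 - 2 * s)"
      by (simp add: powr_add[symmetric] algebra_simps)
    then have e: "snr \<kappa> \<tau> \<sigma> j / real j powr (- (2 * a + 2 * s + 1)) = ?u * ?v / \<sigma>\<^sup>2"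
      by (simp add: snr_def)
    have "k1 * t1 \<le> ?u * ?v" using k t j by (intro mult_mono) auto
    moreover have "?u * ?v \<le> k2 * t2" using k t j by (intro mult_mono) auto
    ultimately show ?thesis unfolding e using \<sigma> by (intro conjI divide_right_mono) simp_all
  qed
  \<comment> \<open>The two constants are ordered because they enclose the value at
    \<open>j = 1\<close>.\<close>
  have "k1 * t1 / \<sigma>\<^sup>2 \<le> k2 * t2 / \<sigma>\<^sup>2" using bd[of 1] by linarith
  moreover have "k1 * t1 / \<sigma>\<^sup>2 > 0" using k t \<sigma> by simp
  moreover have "k1 * t1 / \<sigma>\<^sup>2 * real j powr (- (2 * a + 2 * s + 1)) \<le> snr \<kappa> \<tau> \<sigma> j \<and>
      snr \<kappa> \<tau> \<sigma> j \<le> k2 * t2 / \<sigma>\<^sup>2 * real j powr (- (2 * a + 2 * s + 1))" if j: "j \<ge> 1" for j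
  proof -
    have "real j powr (- (2 * a + 2 * s + 1)) > 0" using j by simp
    then show ?thesis using bd[OF j] by (metis pos_le_divide_eq pos_divide_le_eq)
  qed
  ultimately show ?thesis by blast
qed

theorem corollary1:
  fixes M :: "'w measure"
    and \<theta> \<epsilon> :: "nat \<Rightarrow> 'w \<Rightarrow> real"
    and \<kappa> \<tau> :: "nat \<Rightarrow> real"
    and \<sigma> :: real
  assumes "gaussian_sequence_experiment M \<theta> \<epsilon> \<kappa> \<tau> \<sigma>"
  shows "(\<forall>q c1 c2 :: real.
            antimono_on {1..} (snr \<kappa> \<tau> \<sigma>) \<and> q > 1 \<and> 0 < c1 \<and> c1 \<le> c2 \<and>
            (\<forall>j\<ge>1. c1 * real j powr (-q) \<le> snr \<kappa> \<tau> \<sigma> j \<and> snr \<kappa> \<tau> \<sigma> j \<le> c2 * real j powr (-q))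
            \<longrightarrow> comparable_on {1..} (info M \<theta> \<epsilon> \<kappa>) (\<lambda>n. real n powr (1/q)) \<and>
                comparable_on {3..} (d_eff M \<theta> \<epsilon> \<kappa>) (\<lambda>n. real n powr (1/q) / ln (real n)))
       \<and> (\<forall>a s :: real.
            comparable_on {1..} (\<lambda>j. (\<kappa> j)\<^sup>2) (\<lambda>j. real j powr (- 2 * a)) \<and>
            comparable_on {1..} (\<lambda>j. (\<tau> j)\<^sup>2) (\<lambda>j. real j powr (- 1 - 2 * s)) \<and>
            2 * a + 2 * s + 1 > 1
            \<longrightarrow> comparable_on {3..} (d_eff M \<theta> \<epsilon> \<kappa>)
                  (\<lambda>n. real n powr (1 / (2 * a + 2 * s + 1)) / ln (real n)))"
proof (intro conjI allI impI)
  fix q c1 c2 :: real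
  assume A: "antimono_on {1..} (snr \<kappa> \<tau> \<sigma>) \<and> q > 1 \<and> 0 < c1 \<and> c1 \<le> c2 \<and>
    (\<forall>j\<ge>1. c1 * real j powr (-q) \<le> snr \<kappa> \<tau> \<sigma> j \<and> snr \<kappa> \<tau> \<sigma> j \<le> c2 * real j powr (-q))"
  show "comparable_on {1..} (info M \<theta> \<epsilon> \<kappa>) (\<lambda>n. real n powr (1/q))"
    "comparable_on {3..} (d_eff M \<theta> \<epsilon> \<kappa>) (\<lambda>n. real n powr (1/q) / ln (real n))"
    by (rule comparable_info[OF assms, of q c1 c2]; use A in blast)+
next
  fix a s :: real
  assume A: "comparable_on {1..} (\<lambda>j. (\<kappa> j)\<^sup>2) (\<lambda>j. real j powr (- 2 * a)) \<and>
    comparable_on {1..} (\<lambda>j. (\<tau> j)\<^sup>2) (\<lambda>j. real j powr (- 1 - 2 * s)) \<and>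
    2 * a + 2 * s + 1 > 1"
  have "\<sigma> > 0" using assms by (simp add: gaussian_sequence_experiment_def)
  \<comment> \<open>The special case is the general power law with exponent
    \<open>q = 2 * a + 2 * s + 1\<close>.\<close>
  then obtain c1 c2 where c: "0 < c1" "c1 \<le> c2"
    "\<And>j. j \<ge> 1 \<Longrightarrow> c1 * real j powr (- (2 * a + 2 * s + 1)) \<le> snr \<kappa> \<tau> \<sigma> j"
    "\<And>j. j \<ge> 1 \<Longrightarrow> snr \<kappa> \<tau> \<sigma> j \<le> c2 * real j powr (- (2 * a + 2 * s + 1))"
    using snr_power_law A by metis
  show "comparable_on {3..} (d_eff M \<theta> \<epsilon> \<kappa>)
      (\<lambda>n. real n powr (1 / (2 * a + 2 * s + 1)) / ln (real n))"
    using A by (intro comparable_info(2)[OF assms _ c]) auto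
qed

end
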